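(* Let $\mathcal{A}=\bigcup_p\Phi_p'$ be a unital strong algebra, with associated constants $d$ and $A_{p,q}$ (as defined in the context). For any $a\in\mathcal{A}$, $$\sigma(a)\subseteq\Big\{z\in\mathbb{C}:|z|\le\inf_{\{(p,q):\,p>q+d\}}A_{p,q}\|a\|_q\Big\}.$$
   Context: A countably normed space $\Phi$ is a locally convex (complex) space whose topology is defined by a countable family of compatible norms $(\|\cdot\|_p)_{p\in\mathbb N}$, i.e. if a sequence that is Cauchy in both $\|\cdot\|_p$ and $\|\cdot\|_q$ converges to zero in one of these norms, then it converges to zero in the other; the sequence of norms is taken non-decreasing in $p$. $\Phi_p$ denotes the completion of $\Phi$ with respect to $\|\cdot\|_p$, so $\Phi_1\supseteq\Phi_2\supseteq\cdots$, and $\Phi$ is complete iff $\Phi=\bigcap_p\Phi_p$. $\Phi'$ is the dual of $\Phi$ and $\Phi_p'$ the Banach dual of $\Phi_p$, with norm $\|f\|_p=\sup_{\|x\|_p\le 1}|f(x)|$; then $\Phi_1'\subseteq\Phi_2'\subseteq\cdots$, $\Phi'=\bigcup_p\Phi_p'$, and these dual norms are non-increasing in $p$. Strong algebra: a dual $\mathcal A=\bigcup_p\Phi_p'$ of a complete reflexive countably normed space $\Phi$, which is moreover an algebra over $\mathbb C$, such that there exists a constant $d$ such that for any $q$ and any $p>q+d$ there exists a positive constant $A_{p,q}$ such that for any $a\in\Phi_q'$ and $b\in\Phi_p'$: $\|ab\|_p\le A_{p,q}\|a\|_q\|b\|_p$ and $\|ba\|_p\le A_{p,q}\|a\|_q\|b\|_p$.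 Unital means that $\mathcal A$ has a multiplicative unit $1$. The spectrum of $a\in\mathcal A$ is $\sigma(a)=\{\lambda\in\mathbb C: a-\lambda\text{ is not invertible}\}$, where $\lambda$ stands for $\lambda\cdot 1$. The norm $\|a\|_q$ is finite only when $a\in\Phi_q'$; put $\|a\|_q=\infty$ otherwise. *)

theory Defs
  imports "HOL-Analysis.Analysis" "HOL-Library.Function_Algebras"
begin

text \<open>
  Complex vector spaces are types with an explicit scalar multiplication
  \<open>sc\<close> satisfying the library locale \<^locale>\<open>vector_space\<close>.
\<close>

definition cnorm_on :: "(complex \<Rightarrow> 'v::ab_group_add \<Rightarrow> 'v) \<Rightarrow> ('v \<Rightarrow> real) \<Rightarrow> bool" where
  "cnorm_on sc N \<longleftrightarrow>
     (\<forall>x. 0 \<le> N x) \<and> (\<forall>x. N x = 0 \<longleftrightarrow> x = 0) \<and>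
     (\<forall>x y. N (x + y) \<le> N x + N y) \<and> (\<forall>c x. N (sc c x) = cmod c * N x)"

definition norm_Cauchy :: "('v::ab_group_add \<Rightarrow> real) \<Rightarrow> (nat \<Rightarrow> 'v) \<Rightarrow> bool" where
  "norm_Cauchy N X \<longleftrightarrow> (\<forall>e>0. \<exists>M. \<forall>m\<ge>M. \<forall>n\<ge>M. N (X m - X n) < e)"

definition norm_conv :: "('v::ab_group_add \<Rightarrow> real) \<Rightarrow> (nat \<Rightarrow> 'v) \<Rightarrow> 'v \<Rightarrow> bool" where
  "norm_conv N X x \<longleftrightarrow> (\<lambda>n. N (X n - x)) \<longlonglongrightarrow> 0"


section \<open>The dual of a topological vector space and its strong topology\<close>

text \<open>
  The space is \<open>topspace T\<close>, which may be a proper subset of the type, so that the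
  definitions also apply to a dual space, whose elements are functions. Functionals are
  made unique by being \<open>undefined\<close> outside \<open>topspace T\<close>.
\<close>

definition continuous_dual ::
    "(complex \<Rightarrow> 'v::ab_group_add \<Rightarrow> 'v) \<Rightarrow> 'v topology \<Rightarrow> ('v \<Rightarrow> complex) set" where
  "continuous_dual sc T =
     {f \<in> extensional (topspace T).
        (\<forall>x\<in>topspace T. \<forall>y\<in>topspace T. f (x + y) = f x + f y) \<and>
        (\<forall>c. \<forall>x\<in>topspace T. f (sc c x) = c * f x) \<and>
        continuous_map T euclidean f}"

definition tvs_bounded ::
    "(complex \<Rightarrow> 'v::ab_group_add \<Rightarrow> 'v) \<Rightarrow> 'v topology \<Rightarrow> 'v set \<Rightarrow> bool" where
  "tvs_bounded sc T B \<longleftrightarrow> B \<subseteq> topspace T \<and>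
     (\<forall>U. openin T U \<and> 0 \<in> U \<longrightarrow> (\<exists>r>0. \<forall>c. r \<le> cmod c \<longrightarrow> B \<subseteq> sc c ` U))"

text \<open>
  Uniform convergence on bounded sets: the topology generated by the open balls of the
  seminorms \<open>f \<mapsto> sup\<^sub>B |f|\<close>, \<open>B\<close> bounded.
\<close>

definition strong_dual_topology ::
    "(complex \<Rightarrow> 'v::ab_group_add \<Rightarrow> 'v) \<Rightarrow> 'v topology \<Rightarrow> ('v \<Rightarrow> complex) topology" where
  "strong_dual_topology sc T = topology_generated_by
     {{g \<in> continuous_dual sc T. (SUP x\<in>B. ennreal (cmod (g x - f x))) < ennreal e} | f B e.
        f \<in> continuous_dual sc T \<and> tvs_bounded sc T B \<and> 0 < e}"

definition reflexive_tvs ::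
    "(complex \<Rightarrow> 'v::ab_group_add \<Rightarrow> 'v) \<Rightarrow> 'v topology \<Rightarrow> bool" where
  "reflexive_tvs sc T \<longleftrightarrow>
     homeomorphic_map T
       (strong_dual_topology (\<lambda>c f x. c * f x) (strong_dual_topology sc T))
       (\<lambda>x. \<lambda>f\<in>continuous_dual sc T. f x)"


section \<open>Countably normed spaces\<close>

definition cn_topology :: "(nat \<Rightarrow> 'v::ab_group_add \<Rightarrow> real) \<Rightarrow> 'v topology" where
  "cn_topology N = topology_generated_by {{y. N p (y - x) < e} | p x e. 0 < e}"

locale countably_normed_space = vector_space sc
  for sc :: "complex \<Rightarrow> 'v::ab_group_add \<Rightarrow> 'v" +
  fixes N :: "nat \<Rightarrow> 'v \<Rightarrow> real"
  assumes norms: "cnorm_on sc (N p)"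
    and norms_mono: "p \<le> q \<Longrightarrow> N p x \<le> N q x"
    and norms_compatible:
      "norm_Cauchy (N p) X \<Longrightarrow> norm_Cauchy (N q) X \<Longrightarrow> norm_conv (N p) X 0 \<Longrightarrow> norm_conv (N q) X 0"

text \<open>
  Completeness can be tested on sequences since the topology is metrizable; a sequence is
  Cauchy (convergent) in the topology iff it is so in every norm.
\<close>

definition cn_complete :: "(nat \<Rightarrow> 'v::ab_group_add \<Rightarrow> real) \<Rightarrow> bool" where
  "cn_complete N \<longleftrightarrow>
     (\<forall>X. (\<forall>p. norm_Cauchy (N p) X) \<longrightarrow> (\<exists>x. \<forall>p. norm_conv (N p) X x))"


section \<open>The completion of a normed space and its Banach dual\<close>

text \<open>The completion consists of the classes of Cauchy sequences modulo null sequences.\<close>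

definition completion_class :: "('v::ab_group_add \<Rightarrow> real) \<Rightarrow> (nat \<Rightarrow> 'v) \<Rightarrow> (nat \<Rightarrow> 'v) set" where
  "completion_class N X = {Y. norm_Cauchy N Y \<and> norm_conv N (\<lambda>n. Y n - X n) 0}"

definition completion :: "('v::ab_group_add \<Rightarrow> real) \<Rightarrow> (nat \<Rightarrow> 'v) set set" where
  "completion N = completion_class N ` {X. norm_Cauchy N X}"

definition completion_norm :: "('v::ab_group_add \<Rightarrow> real) \<Rightarrow> (nat \<Rightarrow> 'v) set \<Rightarrow> real" where
  "completion_norm N K = (THE r. \<forall>X\<in>K. (\<lambda>n. N (X n)) \<longlonglongrightarrow> r)"

definition completion_embed :: "('v::ab_group_add \<Rightarrow> real) \<Rightarrow> 'v \<Rightarrow> (nat \<Rightarrow> 'v) set" where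
  "completion_embed N x = completion_class N (\<lambda>n. x)"

definition completion_dual ::
    "(complex \<Rightarrow> 'v::ab_group_add \<Rightarrow> 'v) \<Rightarrow> ('v \<Rightarrow> real) \<Rightarrow> ((nat \<Rightarrow> 'v) set \<Rightarrow> complex) set" where
  "completion_dual sc N =
     {F \<in> extensional (completion N).
        (\<forall>X Y. norm_Cauchy N X \<and> norm_Cauchy N Y \<longrightarrow>
           F (completion_class N (\<lambda>n. X n + Y n)) =
           F (completion_class N X) + F (completion_class N Y)) \<and>
        (\<forall>c X. norm_Cauchy N X \<longrightarrow>
           F (completion_class N (\<lambda>n. sc c (X n))) = c * F (completion_class N X)) \<and>
        (\<exists>C. \<forall>K\<in>completion N. cmod (F K) \<le> C * completion_norm N K)}"

text \<open>
  For the inclusions between the duals \<open>\<Phi>\<^sub>p'\<close> and \<open>\<Phi>'\<close> to make sense, a functional on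
  \<open>\<Phi>\<^sub>p\<close> is identified with its restriction to the dense subspace \<open>\<Phi>\<close>, which
  determines it.
\<close>

definition dual_extensions ::
    "(complex \<Rightarrow> 'v::ab_group_add \<Rightarrow> 'v) \<Rightarrow> ('v \<Rightarrow> real) \<Rightarrow> ('v \<Rightarrow> complex) \<Rightarrow>
     ((nat \<Rightarrow> 'v) set \<Rightarrow> complex) set" where
  "dual_extensions sc N f = {F \<in> completion_dual sc N. \<forall>x. F (completion_embed N x) = f x}"

definition banach_dual ::
    "(complex \<Rightarrow> 'v::ab_group_add \<Rightarrow> 'v) \<Rightarrow> ('v \<Rightarrow> real) \<Rightarrow> ('v \<Rightarrow> complex) set" where
  "banach_dual sc N = {f. dual_extensions sc N f \<noteq> {}}"

text \<open>
  The infimum ranges over at most one extension; it is \<open>\<infinity>\<close> precisely when there is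
  none, i.e. when \<open>f\<close> is not in the dual.
\<close>

definition dual_norm ::
    "(complex \<Rightarrow> 'v::ab_group_add \<Rightarrow> 'v) \<Rightarrow> ('v \<Rightarrow> real) \<Rightarrow> ('v \<Rightarrow> complex) \<Rightarrow> ennreal" where
  "dual_norm sc N f =
     (INF F\<in>dual_extensions sc N f.
        SUP K\<in>{K \<in> completion N. completion_norm N K \<le> 1}. ennreal (cmod (F K)))"


section \<open>Strong algebras\<close>

definition cn_dual ::
    "(complex \<Rightarrow> 'v::ab_group_add \<Rightarrow> 'v) \<Rightarrow> (nat \<Rightarrow> 'v \<Rightarrow> real) \<Rightarrow> ('v \<Rightarrow> complex) set" where
  "cn_dual sc N = (\<Union>p. banach_dual sc (N p))"

text \<open>
  Sums and scalar multiples in the algebra are the pointwise ones of functionals; its product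
  is \<open>mul\<close> (the pointwise product of functions plays no role).
\<close>

locale strong_algebra = countably_normed_space sc N
  for sc :: "complex \<Rightarrow> 'v::ab_group_add \<Rightarrow> 'v" and N :: "nat \<Rightarrow> 'v \<Rightarrow> real" +
  fixes mul :: "('v \<Rightarrow> complex) \<Rightarrow> ('v \<Rightarrow> complex) \<Rightarrow> ('v \<Rightarrow> complex)"
    and d :: real
    and A :: "nat \<Rightarrow> nat \<Rightarrow> real"
  assumes complete: "cn_complete N"
    and reflexive: "reflexive_tvs sc (cn_topology N)"
    and mul_closed: "a \<in> cn_dual sc N \<Longrightarrow> b \<in> cn_dual sc N \<Longrightarrow> mul a b \<in> cn_dual sc N"
    and mul_assoc: "a \<in> cn_dual sc N \<Longrightarrow> b \<in> cn_dual sc N \<Longrightarrow> c \<in> cn_dual sc N \<Longrightarrow>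
      mul (mul a b) c = mul a (mul b c)"
    and mul_add_left: "a \<in> cn_dual sc N \<Longrightarrow> b \<in> cn_dual sc N \<Longrightarrow> c \<in> cn_dual sc N \<Longrightarrow>
      mul (a + b) c = mul a c + mul b c"
    and mul_add_right: "a \<in> cn_dual sc N \<Longrightarrow> b \<in> cn_dual sc N \<Longrightarrow> c \<in> cn_dual sc N \<Longrightarrow>
      mul a (b + c) = mul a b + mul a c"
    and mul_scale_left: "a \<in> cn_dual sc N \<Longrightarrow> b \<in> cn_dual sc N \<Longrightarrow>
      mul (\<lambda>x. z * a x) b = (\<lambda>x. z * mul a b x)"
    and mul_scale_right: "a \<in> cn_dual sc N \<Longrightarrow> b \<in> cn_dual sc N \<Longrightarrow>
      mul a (\<lambda>x. z * b x) = (\<lambda>x. z * mul a b x)"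
    and A_pos: "real p > real q + d \<Longrightarrow> A p q > 0"
    and norm_mul_left: "real p > real q + d \<Longrightarrow>
      a \<in> banach_dual sc (N q) \<Longrightarrow> b \<in> banach_dual sc (N p) \<Longrightarrow>
      dual_norm sc (N p) (mul a b) \<le> ennreal (A p q) * dual_norm sc (N q) a * dual_norm sc (N p) b"
    and norm_mul_right: "real p > real q + d \<Longrightarrow>
      a \<in> banach_dual sc (N q) \<Longrightarrow> b \<in> banach_dual sc (N p) \<Longrightarrow>
      dual_norm sc (N p) (mul b a) \<le> ennreal (A p q) * dual_norm sc (N q) a * dual_norm sc (N p) b"

locale unital_strong_algebra = strong_algebra sc N mul d A
  for sc :: "complex \<Rightarrow> 'v::ab_group_add \<Rightarrow> 'v" and N :: "nat \<Rightarrow> 'v \<Rightarrow> real"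
    and mul :: "('v \<Rightarrow> complex) \<Rightarrow> ('v \<Rightarrow> complex) \<Rightarrow> ('v \<Rightarrow> complex)"
    and d :: real and A :: "nat \<Rightarrow> nat \<Rightarrow> real" +
  fixes unit :: "'v \<Rightarrow> complex"
  assumes unit_closed: "unit \<in> cn_dual sc N"
    and unit_left: "a \<in> cn_dual sc N \<Longrightarrow> mul unit a = a"
    and unit_right: "a \<in> cn_dual sc N \<Longrightarrow> mul a unit = a"

definition alg_invertible ::
    "('v \<Rightarrow> complex) set \<Rightarrow> (('v \<Rightarrow> complex) \<Rightarrow> ('v \<Rightarrow> complex) \<Rightarrow> ('v \<Rightarrow> complex)) \<Rightarrow>
     ('v \<Rightarrow> complex) \<Rightarrow> ('v \<Rightarrow> complex) \<Rightarrow> bool" where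
  "alg_invertible S mul unit a \<longleftrightarrow> (\<exists>b\<in>S. mul a b = unit \<and> mul b a = unit)"

definition alg_spectrum ::
    "('v \<Rightarrow> complex) set \<Rightarrow> (('v \<Rightarrow> complex) \<Rightarrow> ('v \<Rightarrow> complex) \<Rightarrow> ('v \<Rightarrow> complex)) \<Rightarrow>
     ('v \<Rightarrow> complex) \<Rightarrow> ('v \<Rightarrow> complex) \<Rightarrow> complex set" where
  "alg_spectrum S mul unit a = {z. \<not> alg_invertible S mul unit (a - (\<lambda>x. z * unit x))}"

end

theory Submission
  imports Defs
begin

text \<open>
  Let \<open>p > q + d\<close> and \<open>|z| > A p q * \<parallel>a\<parallel>\<^sub>q\<close>, and put \<open>c = a / z\<close>. Left and right
  multiplication by \<open>c\<close> are strict contractions of \<open>\<Phi>\<^sub>p'\<close>. If \<open>c\<close> itself lies in \<open>\<Phi>\<^sub>p'\<close>, the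
  Neumann series solve \<open>s - c s = c\<close> and \<open>t - t c = c\<close> there, and \<open>1 + s = 1 + t\<close>
  inverts \<open>1 - c\<close>.

  Since \<open>d\<close> may be negative, \<open>c\<close> lies in \<open>\<Phi>\<^sub>q'\<close>, but it is not clear that it lies in
  \<open>\<Phi>\<^sub>p'\<close> when \<open>p < q\<close>. In that case \<open>d < -1\<close>, so each \<open>\<Phi>\<^sub>n'\<close> is an ideal of \<open>\<Phi>\<^bsub>n+1\<^esub>'\<close>. If
  \<open>r\<close> is the first level whose dual contains \<open>1\<close>, then \<open>\<Phi>\<^sub>r'\<close> is the whole algebra and all
  later norms are equivalent to the \<open>r\<close>-th. Suppose \<open>r > 0\<close>. The ideal \<open>\<Phi>\<^bsub>r-1\<^esub>'\<close> separates the
  points of \<open>\<Phi>\<close>, hence is norm dense by reflexivity and Hahn-Banach, hence contains an invertible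
  element, hence \<open>1\<close>: a contradiction. So \<open>1\<close> lies in every \<open>\<Phi>\<^sub>p'\<close>, and so does \<open>c = c 1\<close>.
\<close>

section \<open>The Hahn-Banach theorem for seminorms\<close>

text \<open>Only an inequality is required for scaling, since it is easier to verify for infima;
  equality follows by scaling back with \<open>1/t\<close>.\<close>

definition sublinear_on :: "(complex \<Rightarrow> 'a::ab_group_add \<Rightarrow> 'a) \<Rightarrow> 'a set \<Rightarrow> ('a \<Rightarrow> real) \<Rightarrow> bool" where
  "sublinear_on sc E q \<longleftrightarrow>
     (\<forall>x\<in>E. \<forall>y\<in>E. q (x + y) \<le> q x + q y) \<and>
     (\<forall>t>0. \<forall>x\<in>E. q (sc (of_real t) x) \<le> t * q x)"


text \<open>Everything is relative to a subspace \<open>E\<close> because Hahn-Banach is also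
  applied to the dual, which is only a subspace of the type of all functions.\<close>

locale complex_subspace = vector_space sc
  for sc :: "complex \<Rightarrow> 'a::ab_group_add \<Rightarrow> 'a" +
  fixes E :: "'a set"
  assumes sub: "subspace E"
begin

lemma E_add: "x \<in> E \<Longrightarrow> y \<in> E \<Longrightarrow> x + y \<in> E"
  and E_scale: "x \<in> E \<Longrightarrow> sc c x \<in> E"
  and E_zero: "0 \<in> E"
  and E_neg: "x \<in> E \<Longrightarrow> - x \<in> E"
  using sub by (auto simp: subspace_add subspace_scale subspace_0 subspace_neg)

lemma sublinear_add: "sublinear_on sc E q \<Longrightarrow> x \<in> E \<Longrightarrow> y \<in> E \<Longrightarrow> q (x + y) \<le> q x + q y"
  and sublinear_scale_le: "sublinear_on sc E q \<Longrightarrow> t > 0 \<Longrightarrow> x \<in> E \<Longrightarrow> q (sc (of_real t) x) \<le> t * q x"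
  by (auto simp: sublinear_on_def)

section \<open>Sublinear functionals and their minimal elements\<close>

lemma sublinear_zero:
  assumes "sublinear_on sc E q"
  shows "q 0 = 0"
  using sublinear_scale_le[OF assms, of 2 0] sublinear_scale_le[OF assms, of "1/2" 0] E_zero by auto

lemma sublinear_scale:
  assumes q: "sublinear_on sc E q" and "t \<ge> 0" "x \<in> E"
  shows "q (sc (of_real t) x) = t * q x"
proof (cases "t = 0")
  case False
  with assms have t: "t > 0" by simp
  have "q (sc (of_real (1/t)) (sc (of_real t) x)) \<le> (1/t) * q (sc (of_real t) x)"
    using q t by (intro sublinear_scale_le E_scale assms) auto
  then have "t * q x \<le> q (sc (of_real t) x)"
    using t by (simp add: field_simps flip: of_real_mult)
  with sublinear_scale_le[OF q t] assms show ?thesis by (simp add: antisym)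
qed (simp add: sublinear_zero[OF q])

lemma sublinear_ge_neg:
  assumes q: "sublinear_on sc E q" and "x \<in> E"
  shows "- q (- x) \<le> q x"
  using sublinear_add[OF q, of x "- x"] sublinear_zero[OF q] E_neg assms by simp

text \<open>The standard modification of \<open>q\<close> in direction \<open>y\<close>: it lies
  below \<open>q\<close>, and the term \<open>t = 1\<close> bounds it by \<open>- q y\<close> at
  \<open>- y\<close>. An additive functional below it therefore takes at least the value
  \<open>q y\<close> at \<open>y\<close>.\<close>

definition shift :: "('a \<Rightarrow> real) \<Rightarrow> 'a \<Rightarrow> 'a \<Rightarrow> real" where
  "shift q y x = (INF t\<in>{0..}. q (x + sc (of_real t) y) - t * q y)"

lemma shift_le:
  assumes q: "sublinear_on sc E q" and x: "x \<in> E" and y: "y \<in> E" and t: "t \<ge> 0"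
  shows "shift q y x \<le> q (x + sc (of_real t) y) - t * q y"
  unfolding shift_def
proof (rule cINF_lower)
  show "bdd_below ((\<lambda>t. q (x + sc (of_real t) y) - t * q y) ` {0..})"
  proof (rule bdd_belowI2)
    fix s :: real assume s: "s \<in> {0..}"
    \<comment> \<open>The argument on the left is \<open>sc (of_real s) y\<close>, so subadditivity
      bounds all terms of the infimum below by \<open>- q (- x)\<close>.\<close>
    have "q (- x + (x + sc (of_real s) y)) \<le> q (- x) + q (x + sc (of_real s) y)"
      by (intro sublinear_add[OF q] E_neg E_add E_scale x y)
    moreover have "q (sc (of_real s) y) = s * q y"
      using s y by (intro sublinear_scale[OF q]) auto
    ultimately show "- q (- x) \<le> q (x + sc (of_real s) y) - s * q y"
      by simp
  qed
qed (use t in auto)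

lemma shift_ge:
  assumes "\<And>t. t \<ge> 0 \<Longrightarrow> c \<le> q (x + sc (of_real t) y) - t * q y"
  shows "c \<le> shift q y x"
  unfolding shift_def by (rule cINF_greatest) (use assms in auto)

text \<open>Parameters \<open>t\<close> for \<open>x\<close> and \<open>s\<close> for
  \<open>z\<close> combine to the admissible parameter \<open>t + s\<close> for
  \<open>x + z\<close>; for scaling, the parameter \<open>s\<close> becomes
  \<open>t * s\<close>.\<close>

lemma sublinear_shift:
  assumes q: "sublinear_on sc E q" and y: "y \<in> E"
  shows "sublinear_on sc E (shift q y)"
  unfolding sublinear_on_def
proof (intro conjI ballI allI impI)
  fix x z assume x: "x \<in> E" and z: "z \<in> E"
  have "shift q y (x + z) - shift q y z \<le> shift q y x"
  proof (rule shift_ge)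
    fix t :: real assume t: "t \<ge> 0"
    have "shift q y (x + z) - (q (x + sc (of_real t) y) - t * q y) \<le> shift q y z"
    proof (rule shift_ge)
      fix s :: real assume s: "s \<ge> 0"
      have "shift q y (x + z) \<le> q (x + z + sc (of_real (t + s)) y) - (t + s) * q y"
        using t s by (intro shift_le[OF q] E_add x y z) auto
      also have "x + z + sc (of_real (t + s)) y = (x + sc (of_real t) y) + (z + sc (of_real s) y)"
        by (simp add: scale_left_distrib algebra_simps)
      also have "q \<dots> \<le> q (x + sc (of_real t) y) + q (z + sc (of_real s) y)"
        by (intro sublinear_add[OF q] E_add E_scale x y z)
      finally show "shift q y (x + z) - (q (x + sc (of_real t) y) - t * q y)
          \<le> q (z + sc (of_real s) y) - s * q y"
        by (simp add: algebra_simps)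
    qed
    then show "shift q y (x + z) - shift q y z \<le> q (x + sc (of_real t) y) - t * q y" by simp
  qed
  then show "shift q y (x + z) \<le> shift q y x + shift q y z" by simp
next
  fix t :: real and x assume t: "0 < t" and x: "x \<in> E"
  have "shift q y (sc (of_real t) x) / t \<le> shift q y x"
  proof (rule shift_ge)
    fix s :: real assume s: "s \<ge> 0"
    have "shift q y (sc (of_real t) x) \<le> q (sc (of_real t) x + sc (of_real (t * s)) y) - t * s * q y"
      using t s by (intro shift_le[OF q] E_scale x y) auto
    also have "sc (of_real t) x + sc (of_real (t * s)) y = sc (of_real t) (x + sc (of_real s) y)"
      by (simp add: scale_right_distrib)
    also have "q \<dots> = t * q (x + sc (of_real s) y)"
      using t by (intro sublinear_scale[OF q] E_add E_scale x y) auto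
    finally show "shift q y (sc (of_real t) x) / t \<le> q (x + sc (of_real s) y) - s * q y"
      using t by (simp add: field_simps)
  qed
  then show "shift q y (sc (of_real t) x) \<le> t * shift q y x"
    using t by (simp add: field_simps)
qed

text \<open>A minimal sublinear functional \<open>q\<close> is additive, because \<open>shift q y \<le> q\<close> must be
  an equality.\<close>

lemma additive_below_sublinear:
  assumes p: "sublinear_on sc E p"
  obtains u where "sublinear_on sc E u" "\<And>x. x \<in> E \<Longrightarrow> u x \<le> p x"
    "\<And>x y. x \<in> E \<Longrightarrow> y \<in> E \<Longrightarrow> u (x + y) = u x + u y"
proof -
  \<comment> \<open>Members of \<open>Q\<close> vanish off \<open>E\<close>, so minimality yields an
    equation between whole functions. Zorn's lemma is applied to the reversed order, whose maximal
    elements are the minimal sublinear functionals.\<close>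
  define Q where "Q = {q. sublinear_on sc E q \<and> (\<forall>x\<in>E. q x \<le> p x) \<and> (\<forall>x. x \<notin> E \<longrightarrow> q x = 0)}"
  let ?R = "\<lambda>a b :: 'a \<Rightarrow> real. b \<le> a"
  have po: "partial_order_on Q (relation_of ?R Q)"
    by (rule partial_order_on_relation_ofI) auto
  have "\<exists>m\<in>Q. \<forall>a\<in>Q. ?R m a \<longrightarrow> a = m"
  proof (rule predicate_Zorn[OF po])
    fix C assume C: "C \<in> Chains (relation_of ?R Q)"
    have CQ: "C \<subseteq> Q" using C by (auto simp: Chains_def relation_of_def)
    have tot: "a \<le> b \<or> b \<le> a" if "a \<in> C" "b \<in> C" for a b
      using C that by (auto simp: Chains_def relation_of_def)
    show "\<exists>u\<in>Q. \<forall>a\<in>C. u \<le> a"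
    proof (cases "C = {}")
      case True
      have "(\<lambda>x. if x \<in> E then p x else 0) \<in> Q"
        using p by (auto simp: Q_def sublinear_on_def E_add E_scale)
      then show ?thesis using True by auto
    next
      case False
      define u where "u x = (INF q\<in>C. q x)" for x
      have bdd: "bdd_below ((\<lambda>q. q x) ` C)" for x
      proof (rule bdd_belowI2)
        fix q assume "q \<in> C"
        then have q: "q \<in> Q" using CQ by auto
        \<comment> \<open>This bound does not depend on \<open>q\<close>, so the pointwise infimum
          of a nonempty chain is finite.\<close>
        show "(if x \<in> E then - p (- x) else 0) \<le> q x"
        proof (cases "x \<in> E")
          case True
          then have "- q (- x) \<le> q x" "q (- x) \<le> p (- x)"
            using q sublinear_ge_neg[of q x] E_neg by (auto simp: Q_def)
          then show ?thesis using True by simp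
        qed (use q in \<open>auto simp: Q_def\<close>)
      qed
      have low: "u x \<le> q x" if "q \<in> C" for q x
        unfolding u_def using bdd that by (intro cINF_lower)
      have ge: "c \<le> u x" if "\<And>q. q \<in> C \<Longrightarrow> c \<le> q x" for c x
        unfolding u_def using that False by (intro cINF_greatest)
      have "u \<in> Q" unfolding Q_def sublinear_on_def
      proof (intro CollectI conjI ballI allI impI)
        fix x y assume x: "x \<in> E" and y: "y \<in> E"
        have "u (x + y) - u y \<le> u x"
        proof (rule ge)
          fix q1 assume q1: "q1 \<in> C"
          have "u (x + y) - q1 x \<le> u y"
          proof (rule ge)
            fix q2 assume q2: "q2 \<in> C"
            \<comment> \<open>In a chain, one of \<open>q1\<close> and \<open>q2\<close> lies below
              the other and serves for both points.\<close>
            obtain q where q: "q \<in> C" "q x \<le> q1 x" "q y \<le> q2 y"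
              using tot[OF q1 q2] q1 q2 by (auto simp: le_fun_def)
            have "u (x + y) \<le> q (x + y)" using q by (intro low)
            also have "\<dots> \<le> q x + q y" using q CQ x y by (auto simp: Q_def intro: sublinear_add)
            finally show "u (x + y) - q1 x \<le> q2 y" using q by simp
          qed
          then show "u (x + y) - u y \<le> q1 x" by simp
        qed
        then show "u (x + y) \<le> u x + u y" by simp
      next
        fix t :: real and x assume t: "0 < t" and x: "x \<in> E"
        have "u (sc (of_real t) x) / t \<le> u x"
        proof (rule ge)
          fix q assume q: "q \<in> C"
          have "u (sc (of_real t) x) \<le> q (sc (of_real t) x)" using q by (rule low)
          also have "\<dots> \<le> t * q x" using q CQ t x by (auto simp: Q_def intro: sublinear_scale_le)
          finally show "u (sc (of_real t) x) / t \<le> q x" using t by (simp add: field_simps)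
        qed
        then show "u (sc (of_real t) x) \<le> t * u x" using t by (simp add: field_simps)
      next
        fix x assume "x \<in> E"
        then show "u x \<le> p x" using False low[of _ x] CQ by (force simp: Q_def)
      next
        fix x assume "x \<notin> E"
        then have "u x = (INF q\<in>C. 0)"
          unfolding u_def using CQ by (intro INF_cong) (auto simp: Q_def)
        then show "u x = 0" using False by simp
      qed
      then show ?thesis using low by (auto simp: le_fun_def)
    qed
  qed
  then obtain u where u: "u \<in> Q" and min: "\<And>a. a \<in> Q \<Longrightarrow> a \<le> u \<Longrightarrow> a = u" by auto
  have us: "sublinear_on sc E u" and up: "\<And>x. x \<in> E \<Longrightarrow> u x \<le> p x" and u0: "\<And>x. x \<notin> E \<Longrightarrow> u x = 0"
    using u by (auto simp: Q_def)
  have "u (x + y) = u x + u y" if x: "x \<in> E" and y: "y \<in> E" for x y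
  proof -
    define v where "v z = (if z \<in> E then shift u y z else 0)" for z
    have vu: "v z \<le> u z" for z
      using shift_le[OF us _ y, of z 0] u0 by (auto simp: v_def)
    have "v \<in> Q"
      using sublinear_shift[OF us y] vu up order_trans[OF vu up]
      by (auto simp: Q_def v_def sublinear_on_def E_add E_scale)
    then have "v = u" using min vu by (auto simp: le_fun_def)
    then have "u x = shift u y x" using x by (auto simp: v_def fun_eq_iff split: if_splits)
    \<comment> \<open>The term \<open>t = 1\<close> of the infimum gives superadditivity, the
      missing half of additivity.\<close>
    also have "\<dots> \<le> u (x + y) - u y"
      using shift_le[OF us x y, of 1] by simp
    finally show ?thesis using sublinear_add[OF us x y] by simp
  qed
  with us up show ?thesis by (intro that)
qed

text \<open>An additive real functional is taken below \<open>shift P x0\<close> instead of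
  \<open>P\<close>; this forces the value \<open>P x0\<close> at \<open>x0\<close>. It serves as the
  real part of the complex functional.\<close>

lemma hahn_banach:
  assumes P_add: "\<And>x y. x \<in> E \<Longrightarrow> y \<in> E \<Longrightarrow> P (x + y) \<le> P x + P y"
    and P_scale: "\<And>c x. x \<in> E \<Longrightarrow> P (sc c x) = cmod c * P x"
    and x0: "x0 \<in> E"
  obtains f where "\<And>x y. x \<in> E \<Longrightarrow> y \<in> E \<Longrightarrow> f (x + y) = f x + f y"
    "\<And>c x. x \<in> E \<Longrightarrow> f (sc c x) = c * f x"
    "\<And>x. x \<in> E \<Longrightarrow> cmod (f x) \<le> P x" "f x0 = of_real (P x0)"
proof -
  have P: "sublinear_on sc E P" by (auto simp: sublinear_on_def P_add P_scale)
  from additive_below_sublinear[OF sublinear_shift[OF P x0]]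
  obtain u where u: "sublinear_on sc E u" and us: "\<And>x. x \<in> E \<Longrightarrow> u x \<le> shift P x0 x"
    and u_add: "\<And>x y. x \<in> E \<Longrightarrow> y \<in> E \<Longrightarrow> u (x + y) = u x + u y"
    by blast
  have uP: "u x \<le> P x" if "x \<in> E" for x
    using us[OF that] shift_le[OF P that x0, of 0] by simp
  have u_neg: "u (- x) = - u x" if "x \<in> E" for x
    using u_add[OF that E_neg[OF that]] sublinear_zero[OF u] by simp
  have u_scale: "u (sc (of_real t) x) = t * u x" if "x \<in> E" for t x
  proof (cases "t \<ge> 0")
    case False
    then have "u (sc (of_real (- t)) x) = - t * u x"
      using that by (intro sublinear_scale[OF u]) auto
    then show ?thesis using u_neg[OF E_scale[OF that], of "of_real t"] by simp
  qed (use sublinear_scale[OF u] that in auto)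
  have "- u x0 \<le> - P x0"
    using us[OF E_neg[OF x0]] shift_le[OF P E_neg[OF x0] x0, of 1] sublinear_zero[OF P]
    by (simp add: u_neg x0)
  then have ux0: "u x0 = P x0" using uP[OF x0] by simp
  \<comment> \<open>A complex-linear functional is recovered from its real part by
    \<open>f x = u x - \<i> * u (sc \<i> x)\<close>.\<close>
  define f where "f x = Complex (u x) (- u (sc \<i> x))" for x
  have f_add: "f (x + y) = f x + f y" if "x \<in> E" "y \<in> E" for x y
    using that by (simp add: f_def u_add E_scale scale_right_distrib complex_eq_iff)
  have f_scale: "f (sc c x) = c * f x" if x: "x \<in> E" for c x
  proof -
    have dec: "u (sc (Complex s t) x) = s * u x + t * u (sc \<i> x)" for s t
    proof -
      have "sc (Complex s t) x = sc (of_real s) x + sc (of_real t) (sc \<i> x)"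
        by (simp add: Complex_eq scale_left_distrib mult.commute)
      also have "u \<dots> = u (sc (of_real s) x) + u (sc (of_real t) (sc \<i> x))"
        using x by (intro u_add E_scale)
      also have "\<dots> = s * u x + t * u (sc \<i> x)"
        using u_scale[OF x] u_scale[OF E_scale[OF x]] by (simp only:)
      finally show ?thesis .
    qed
    have "\<i> * c = Complex (- Im c) (Re c)" by (simp add: complex_eq_iff)
    then have "u (sc \<i> (sc c x)) = - Im c * u x + Re c * u (sc \<i> x)"
      using dec[of "- Im c" "Re c"] by simp
    moreover have "u (sc c x) = Re c * u x + Im c * u (sc \<i> x)"
      using dec[of "Re c" "Im c"] by simp
    ultimately show ?thesis
      by (simp add: f_def complex_eq_iff algebra_simps)
  qed
  have f_le: "cmod (f x) \<le> P x" if x: "x \<in> E" for x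
  proof -
    \<comment> \<open>A unimodular factor rotates \<open>f x\<close> onto the nonnegative real axis,
      where the bound on the real part \<open>u\<close> applies.\<close>
    obtain c where c: "cmod c = 1" "c * f x = of_real (cmod (f x))"
    proof (cases "f x = 0")
      case False
      then show ?thesis
        by (intro that[of "of_real (cmod (f x)) / f x"]) (auto simp: norm_divide)
    qed (use that[of 1] in auto)
    have "cmod (f x) = Re (f (sc c x))" using c x by (simp add: f_scale)
    also have "\<dots> = u (sc c x)" by (simp add: f_def)
    also have "\<dots> \<le> P (sc c x)" using x by (intro uP E_scale)
    also have "\<dots> = P x" using x c by (simp add: P_scale)
    finally show ?thesis .
  qed
  have "Re (f x0) = P x0" by (simp add: f_def ux0)
  \<comment> \<open>The real part alone already exhausts the bound on the modulus.\<close>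
  moreover have "Im (f x0) = 0"
  proof -
    have "(Re (f x0))\<^sup>2 + (Im (f x0))\<^sup>2 \<le> (P x0)\<^sup>2"
      using power_mono[OF f_le[OF x0], of 2] by (simp add: cmod_power2)
    then show ?thesis using \<open>Re (f x0) = P x0\<close> by simp
  qed
  ultimately have "f x0 = of_real (P x0)" by (simp add: complex_eq_iff)
  then show ?thesis using f_add f_scale f_le by (intro that)
qed

text \<open>The distance \<open>P\<close> to \<open>F\<close> with respect to \<open>p\<close> is
  again a seminorm. It vanishes on \<open>F\<close> and is at least \<open>e\<close> at
  \<open>x0\<close>, so a functional dominated by \<open>P\<close> with value \<open>P x0\<close> at
  \<open>x0\<close> separates.\<close>

lemma hahn_banach_separation:
  assumes p_nonneg: "\<And>x. x \<in> E \<Longrightarrow> 0 \<le> p x"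
    and p_add: "\<And>x y. x \<in> E \<Longrightarrow> y \<in> E \<Longrightarrow> p (x + y) \<le> p x + p y"
    and p_scale: "\<And>c x. x \<in> E \<Longrightarrow> p (sc c x) = cmod c * p x"
    and F: "subspace F" "F \<subseteq> E"
    and x0: "x0 \<in> E"
    and far: "0 < e" "\<And>u. u \<in> F \<Longrightarrow> e \<le> p (x0 - u)"
  obtains f where "\<And>x y. x \<in> E \<Longrightarrow> y \<in> E \<Longrightarrow> f (x + y) = f x + f y"
    "\<And>c x. x \<in> E \<Longrightarrow> f (sc c x) = c * f x"
    "\<And>x. x \<in> E \<Longrightarrow> cmod (f x) \<le> p x" "\<And>u. u \<in> F \<Longrightarrow> f u = 0" "f x0 \<noteq> 0"
proof -
  define P where "P x = (INF u\<in>F. p (x - u))" for x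
  have F0: "0 \<in> F" using F by (simp add: subspace_0)
  have E_diff: "x - u \<in> E" if "x \<in> E" "u \<in> F" for x u
    using E_add[OF that(1) E_neg[of u]] that F by auto
  have P_le: "P x \<le> p (x - u)" if "x \<in> E" "u \<in> F" for x u
    unfolding P_def using that
    by (intro cINF_lower bdd_belowI2[where m = 0]) (auto intro: p_nonneg E_diff)
  have P_ge: "c \<le> P x" if "\<And>u. u \<in> F \<Longrightarrow> c \<le> p (x - u)" for c x
    unfolding P_def using that F0 by (intro cINF_greatest) auto
  have P_add: "P (x + y) \<le> P x + P y" if x: "x \<in> E" and y: "y \<in> E" for x y
  proof -
    have "P (x + y) - P y \<le> P x"
    proof (rule P_ge)
      fix u assume u: "u \<in> F"
      have "P (x + y) - p (x - u) \<le> P y"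
      proof (rule P_ge)
        fix v assume v: "v \<in> F"
        have "P (x + y) \<le> p (x + y - (u + v))"
          using u v F x y by (intro P_le E_add) (auto simp: subspace_add)
        also have "x + y - (u + v) = (x - u) + (y - v)" by simp
        also have "p \<dots> \<le> p (x - u) + p (y - v)" by (intro p_add E_diff x y u v)
        finally show "P (x + y) - p (x - u) \<le> p (y - v)" by simp
      qed
      then show "P (x + y) - P y \<le> p (x - u)" by simp
    qed
    then show ?thesis by simp
  qed
  have P_scale_le: "P (sc c x) \<le> cmod c * P x" if x: "x \<in> E" for c x
  proof (cases "c = 0")
    case True
    then show ?thesis using P_le[OF E_zero F0] p_scale[OF E_zero, of 0] by simp
  next
    case False
    have "P (sc c x) / cmod c \<le> P x"
    proof (rule P_ge)
      fix u assume u: "u \<in> F"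
      have "P (sc c x) \<le> p (sc c x - sc c u)"
        using u F x by (intro P_le E_scale) (auto simp: subspace_scale)
      also have "\<dots> = cmod c * p (x - u)"
        using p_scale[OF E_diff[OF x u], of c] by (simp add: scale_right_diff_distrib)
      finally show "P (sc c x) / cmod c \<le> p (x - u)" using False by (simp add: field_simps)
    qed
    then show ?thesis using False by (simp add: field_simps)
  qed
  have P_scale: "P (sc c x) = cmod c * P x" if x: "x \<in> E" for c x
  proof (cases "c = 0")
    case True
    have "0 \<le> P (sc c x)" using E_diff x by (intro P_ge p_nonneg) (auto intro: E_scale)
    then show ?thesis using P_scale_le[OF x, of c] True by simp
  next
    case False
    then have "P x \<le> cmod (1 / c) * P (sc c x)"
      using P_scale_le[OF E_scale[OF x, of c], of "1 / c"] by simp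
    then have "cmod c * P x \<le> P (sc c x)" using False by (simp add: norm_divide field_simps)
    then show ?thesis using P_scale_le[OF x, of c] by simp
  qed
  have "e \<le> P x0" by (rule P_ge) (rule far)
  show ?thesis
  proof (rule hahn_banach[OF P_add P_scale x0])
    fix f assume f: "\<And>x y. x \<in> E \<Longrightarrow> y \<in> E \<Longrightarrow> f (x + y) = f x + f y"
      "\<And>c x. x \<in> E \<Longrightarrow> f (sc c x) = c * f x"
      "\<And>x. x \<in> E \<Longrightarrow> cmod (f x) \<le> P x" "f x0 = of_real (P x0)"
    have "f u = 0" if u: "u \<in> F" for u
    proof -
      have uE: "u \<in> E" using u F by auto
      have "cmod (f u) \<le> p (u - u)" using f(3)[OF uE] P_le[OF uE u] by simp
      then show ?thesis using p_scale[OF E_zero, of 0] by simp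
    qed
    moreover have "cmod (f x) \<le> p x" if "x \<in> E" for x
      using f(3)[OF that] P_le[OF that F0] by simp
    ultimately show thesis using f \<open>e \<le> P x0\<close> far by (intro that[of f]) auto
  qed
qed

end

section \<open>Bounded functionals and the Banach dual\<close>

text \<open>For \<open>C \<ge> 0\<close> this is membership in the Banach dual with norm at most
  \<open>C\<close>, expressed on the uncompleted space; the proofs below work with it instead of
  with functionals on the completion.\<close>

definition bounded_functional ::
    "(complex \<Rightarrow> 'v::ab_group_add \<Rightarrow> 'v) \<Rightarrow> ('v \<Rightarrow> real) \<Rightarrow> real \<Rightarrow> ('v \<Rightarrow> complex) \<Rightarrow> bool" where
  "bounded_functional sc M C f \<longleftrightarrow>
     (\<forall>x y. f (x + y) = f x + f y) \<and> (\<forall>c x. f (sc c x) = c * f x) \<and> (\<forall>x. cmod (f x) \<le> C * M x)"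

locale complex_normed = vector_space sc
  for sc :: "complex \<Rightarrow> 'v::ab_group_add \<Rightarrow> 'v" +
  fixes M :: "'v \<Rightarrow> real"
  assumes M: "cnorm_on sc M"
begin

lemma M_nonneg: "0 \<le> M x"
  and M_eq_0: "M x = 0 \<longleftrightarrow> x = 0"
  and M_triangle: "M (x + y) \<le> M x + M y"
  and M_scale: "M (sc c x) = cmod c * M x"
  using M by (auto simp: cnorm_on_def)

lemma M_0 [simp]: "M 0 = 0"
  by (simp add: M_eq_0)

lemma M_minus: "M (- x) = M x"
  using M_scale[of "- 1" x] by simp

lemma M_diff_le: "\<bar>M x - M y\<bar> \<le> M (x - y)"
  using M_triangle[of "x - y" y] M_triangle[of "y - x" x] M_minus[of "x - y"] by simp

section \<open>Cauchy sequences and the norm of the completion\<close>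

lemma norm_Cauchy_convergent:
  assumes "norm_Cauchy M X"
  shows "convergent (\<lambda>n. M (X n))"
  unfolding Cauchy_convergent_iff[symmetric] Cauchy_def
proof (intro allI impI)
  fix e :: real assume "e > 0"
  then obtain k where "\<And>m n. m \<ge> k \<Longrightarrow> n \<ge> k \<Longrightarrow> M (X m - X n) < e"
    using assms unfolding norm_Cauchy_def by meson
  then have "dist (M (X m)) (M (X n)) < e" if "m \<ge> k" "n \<ge> k" for m n
    using M_diff_le[of "X m" "X n"] that by (force simp: dist_real_def)
  then show "\<exists>k. \<forall>m\<ge>k. \<forall>n\<ge>k. dist (M (X m)) (M (X n)) < e" by blast
qed

lemma norm_Cauchy_const: "norm_Cauchy M (\<lambda>n. x)"
  by (simp add: norm_Cauchy_def)

lemma norm_Cauchy_add: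
  assumes "norm_Cauchy M X" "norm_Cauchy M Y"
  shows "norm_Cauchy M (\<lambda>n. X n + Y n)"
  unfolding norm_Cauchy_def
proof (intro allI impI)
  fix e :: real assume "e > 0"
  then have "e / 2 > 0" by simp
  then obtain k l where k: "\<And>m n. m \<ge> k \<Longrightarrow> n \<ge> k \<Longrightarrow> M (X m - X n) < e / 2"
    and l: "\<And>m n. m \<ge> l \<Longrightarrow> n \<ge> l \<Longrightarrow> M (Y m - Y n) < e / 2"
    using assms unfolding norm_Cauchy_def by meson
  have "M (X m + Y m - (X n + Y n)) < e" if "m \<ge> max k l" "n \<ge> max k l" for m n
    using M_triangle[of "X m - X n" "Y m - Y n"] k[of m n] l[of m n] that
    by (simp add: algebra_simps)
  then show "\<exists>k. \<forall>m\<ge>k. \<forall>n\<ge>k. M (X m + Y m - (X n + Y n)) < e" by blast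
qed

lemma norm_Cauchy_scale:
  assumes "norm_Cauchy M X"
  shows "norm_Cauchy M (\<lambda>n. sc c (X n))"
  unfolding norm_Cauchy_def
proof (intro allI impI)
  fix e :: real assume e: "e > 0"
  have c: "cmod c + 1 > 0" by (smt (verit) norm_ge_zero)
  then have "e / (cmod c + 1) > 0" using e by simp
  then obtain k where k: "\<And>m n. m \<ge> k \<Longrightarrow> n \<ge> k \<Longrightarrow> M (X m - X n) < e / (cmod c + 1)"
    using assms unfolding norm_Cauchy_def by meson
  have "M (sc c (X m) - sc c (X n)) < e" if "m \<ge> k" "n \<ge> k" for m n
  proof -
    have "M (sc c (X m) - sc c (X n)) = cmod c * M (X m - X n)"
      by (simp add: scale_right_diff_distrib flip: M_scale)
    also have "\<dots> \<le> (cmod c + 1) * M (X m - X n)"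
      using M_nonneg by (intro mult_right_mono) auto
    also have "\<dots> < e" using k[OF that] c by (simp add: field_simps)
    finally show ?thesis .
  qed
  then show "\<exists>k. \<forall>m\<ge>k. \<forall>n\<ge>k. M (sc c (X m) - sc c (X n)) < e" by blast
qed

lemma completion_class_self: "norm_Cauchy M X \<Longrightarrow> X \<in> completion_class M X"
  by (simp add: completion_class_def norm_conv_def)

lemma completion_class_norm_tendsto:
  assumes X: "norm_Cauchy M X" and Y: "Y \<in> completion_class M X"
  shows "(\<lambda>n. M (Y n)) \<longlonglongrightarrow> lim (\<lambda>n. M (X n))"
proof (rule Lim_transform)
  show "(\<lambda>n. M (X n)) \<longlonglongrightarrow> lim (\<lambda>n. M (X n))"
    using norm_Cauchy_convergent[OF X] by (simp add: convergent_LIMSEQ_iff)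
  have "(\<lambda>n. M (Y n - X n)) \<longlonglongrightarrow> 0"
    using Y by (simp add: completion_class_def norm_conv_def)
  then show "(\<lambda>n. M (Y n) - M (X n)) \<longlonglongrightarrow> 0"
    by (rule Lim_null_comparison[rotated]) (use M_diff_le in auto)
qed

lemma completion_norm_class:
  assumes X: "norm_Cauchy M X"
  shows "completion_norm M (completion_class M X) = lim (\<lambda>n. M (X n))"
  unfolding completion_norm_def
proof (rule the_equality)
  fix r assume "\<forall>Y\<in>completion_class M X. (\<lambda>n. M (Y n)) \<longlonglongrightarrow> r"
  then have "(\<lambda>n. M (X n)) \<longlonglongrightarrow> r" using completion_class_self[OF X] by auto
  then show "r = lim (\<lambda>n. M (X n))" by (simp add: limI)
qed (use completion_class_norm_tendsto[OF X] in auto)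

lemma completion_norm_embed: "completion_norm M (completion_embed M x) = M x"
  unfolding completion_embed_def
  by (simp add: completion_norm_class norm_Cauchy_const)

lemma completion_embed_in: "completion_embed M x \<in> completion M"
  by (auto simp: completion_def completion_embed_def norm_Cauchy_const)

section \<open>Bounded functionals and their extensions to the completion\<close>

lemma bounded_functional_diff:
  "bounded_functional sc M C f \<Longrightarrow> f (x - y) = f x - f y"
  unfolding bounded_functional_def by (metis add_diff_cancel_right' diff_add_cancel)

lemma bounded_functional_convergent:
  assumes f: "bounded_functional sc M C f" and X: "norm_Cauchy M X"
  shows "convergent (\<lambda>n. f (X n))"
  unfolding Cauchy_convergent_iff[symmetric] Cauchy_def
proof (intro allI impI)
  fix e :: real assume e: "e > 0"
  have C: "\<bar>C\<bar> + 1 > 0" by simp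
  then have "e / (\<bar>C\<bar> + 1) > 0" using e by simp
  then obtain k where k: "\<And>m n. m \<ge> k \<Longrightarrow> n \<ge> k \<Longrightarrow> M (X m - X n) < e / (\<bar>C\<bar> + 1)"
    using X unfolding norm_Cauchy_def by meson
  have "dist (f (X m)) (f (X n)) < e" if "m \<ge> k" "n \<ge> k" for m n
  proof -
    have "dist (f (X m)) (f (X n)) = cmod (f (X m - X n))"
      by (simp add: dist_norm bounded_functional_diff[OF f])
    also have "\<dots> \<le> C * M (X m - X n)" using f by (simp add: bounded_functional_def)
    also have "\<dots> \<le> (\<bar>C\<bar> + 1) * M (X m - X n)"
      using M_nonneg by (intro mult_right_mono) auto
    also have "\<dots> < e" using k[OF that] C by (simp add: field_simps)
    finally show ?thesis .
  qed
  then show "\<exists>k. \<forall>m\<ge>k. \<forall>n\<ge>k. dist (f (X m)) (f (X n)) < e" by blast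
qed

text \<open>The extension is the limit of \<open>f\<close> along a representing Cauchy sequence;
  representatives differ by null sequences, on which \<open>f\<close> tends to 0.\<close>

lemma bounded_functional_banach_dual:
  assumes f: "bounded_functional sc M C f" and C: "C \<ge> 0"
  shows "f \<in> banach_dual sc M" "dual_norm sc M f \<le> ennreal C"
proof -
  have f_add: "f (x + y) = f x + f y" and f_scale: "f (sc c x) = c * f x"
    and f_le: "cmod (f x) \<le> C * M x" for x y c
    using f by (auto simp: bounded_functional_def)
  define F where "F K = (if K \<in> completion M then lim (\<lambda>n. f ((SOME X. X \<in> K) n)) else undefined)" for K
  have F_tendsto: "(\<lambda>n. f (X n)) \<longlonglongrightarrow> F (completion_class M X)" if X: "norm_Cauchy M X" for X
  proof -
    define Y where "Y = (SOME Y. Y \<in> completion_class M X)"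
    have "Y \<in> completion_class M X"
      unfolding Y_def using completion_class_self[OF X] by (metis someI)
    then have Y: "norm_Cauchy M Y" and YX: "(\<lambda>n. M (Y n - X n)) \<longlonglongrightarrow> 0"
      by (auto simp: completion_class_def norm_conv_def)
    have "F (completion_class M X) = lim (\<lambda>n. f (Y n))"
      using X by (simp add: F_def Y_def completion_def)
    then have "(\<lambda>n. f (Y n)) \<longlonglongrightarrow> F (completion_class M X)"
      using bounded_functional_convergent[OF f Y] by (simp add: convergent_LIMSEQ_iff)
    moreover have "(\<lambda>n. f (X n) - f (Y n)) \<longlonglongrightarrow> 0"
    proof (rule Lim_null_comparison)
      show "(\<lambda>n. C * M (Y n - X n)) \<longlonglongrightarrow> 0" using tendsto_mult_right_zero[OF YX] .
      show "\<forall>\<^sub>F n in sequentially. norm (f (X n) - f (Y n)) \<le> C * M (Y n - X n)"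
        using f_le[of "X _ - Y _"] M_minus[of "X _ - Y _"]
        by (simp add: bounded_functional_diff[OF f])
    qed
    ultimately show ?thesis by (rule Lim_transform)
  qed
  have F_le: "cmod (F K) \<le> C * completion_norm M K" if KM: "K \<in> completion M" for K
  proof -
    obtain X where K: "K = completion_class M X" and X: "norm_Cauchy M X"
      using KM by (auto simp: completion_def)
    have "(\<lambda>n. C * M (X n)) \<longlonglongrightarrow> C * completion_norm M K"
      using completion_class_norm_tendsto[OF X completion_class_self[OF X]]
      by (intro tendsto_mult_left) (simp add: K completion_norm_class[OF X])
    then show ?thesis
      using tendsto_norm[OF F_tendsto[OF X]] f_le by (auto simp: K intro: LIMSEQ_le)
  qed
  have "F \<in> dual_extensions sc M f"
    unfolding dual_extensions_def completion_dual_def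
  proof (intro CollectI conjI allI impI)
    show "F \<in> extensional (completion M)" by (simp add: extensional_def F_def)
    fix X Y assume XY: "norm_Cauchy M X \<and> norm_Cauchy M Y"
    then have "(\<lambda>n. f (X n + Y n)) \<longlonglongrightarrow> F (completion_class M X) + F (completion_class M Y)"
      unfolding f_add by (intro tendsto_add F_tendsto) auto
    then show "F (completion_class M (\<lambda>n. X n + Y n)) =
        F (completion_class M X) + F (completion_class M Y)"
      using XY F_tendsto[of "\<lambda>n. X n + Y n"] by (auto intro: LIMSEQ_unique norm_Cauchy_add)
  next
    fix c X assume X: "norm_Cauchy M X"
    then have "(\<lambda>n. f (sc c (X n))) \<longlonglongrightarrow> c * F (completion_class M X)"
      unfolding f_scale by (intro tendsto_mult_left F_tendsto)
    then show "F (completion_class M (\<lambda>n. sc c (X n))) = c * F (completion_class M X)"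
      using X F_tendsto[of "\<lambda>n. sc c (X n)"] by (auto intro: LIMSEQ_unique norm_Cauchy_scale)
  next
    show "\<exists>C. \<forall>K\<in>completion M. cmod (F K) \<le> C * completion_norm M K" using F_le by blast
  next
    fix x
    show "F (completion_embed M x) = f x"
      using F_tendsto[OF norm_Cauchy_const, of x]
      by (simp add: completion_embed_def LIMSEQ_const_iff)
  qed
  moreover have "(SUP K\<in>{K \<in> completion M. completion_norm M K \<le> 1}. ennreal (cmod (F K))) \<le> ennreal C"
  proof (rule SUP_least, rule ennreal_leI)
    fix K assume K: "K \<in> {K \<in> completion M. completion_norm M K \<le> 1}"
    then have "C * completion_norm M K \<le> C * 1" using C by (intro mult_left_mono) auto
    then show "cmod (F K) \<le> C" using F_le[of K] K by simp
  qed
  ultimately show "f \<in> banach_dual sc M" "dual_norm sc M f \<le> ennreal C"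
    by (auto simp: banach_dual_def dual_norm_def intro: INF_lower2)
qed

lemma banach_dual_bounded_functional:
  assumes "f \<in> banach_dual sc M"
  obtains C where "C \<ge> 0" "dual_norm sc M f = ennreal C" "bounded_functional sc M C f"
proof -
  obtain F where F: "F \<in> dual_extensions sc M f" using assms by (auto simp: banach_dual_def)
  have F_embed: "G (completion_embed M x) = f x" if "G \<in> dual_extensions sc M f" for G x
    using that by (auto simp: dual_extensions_def)
  have f_add: "f (x + y) = f x + f y" for x y
    using F norm_Cauchy_const
    by (simp add: dual_extensions_def completion_dual_def completion_embed_def flip: F_embed[OF F])
  have f_scale: "f (sc c x) = c * f x" for c x
    using F norm_Cauchy_const
    by (simp add: dual_extensions_def completion_dual_def completion_embed_def flip: F_embed[OF F])
  obtain C0 where C0: "\<And>K. K \<in> completion M \<Longrightarrow> cmod (F K) \<le> C0 * completion_norm M K"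
    using F unfolding dual_extensions_def completion_dual_def by blast
  have "dual_norm sc M f \<le>
      (SUP K\<in>{K \<in> completion M. completion_norm M K \<le> 1}. ennreal (cmod (F K)))"
    unfolding dual_norm_def by (rule INF_lower[OF F])
  \<comment> \<open>The sign of \<open>C0\<close> is not given, hence the absolute value.\<close>
  also have "\<dots> \<le> ennreal \<bar>C0\<bar>"
  proof (rule SUP_least, rule ennreal_leI)
    fix K assume K: "K \<in> {K \<in> completion M. completion_norm M K \<le> 1}"
    then obtain X where X: "norm_Cauchy M X" "K = completion_class M X"
      by (auto simp: completion_def)
    have "0 \<le> completion_norm M K"
      using completion_class_norm_tendsto[OF X(1) completion_class_self[OF X(1)]] M_nonneg
      by (auto simp: X completion_norm_class intro: LIMSEQ_le_const)
    then have "C0 * completion_norm M K \<le> \<bar>C0\<bar> * 1" using K by (intro mult_mono) auto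
    then show "cmod (F K) \<le> \<bar>C0\<bar>" using C0[of K] K by simp
  qed
  finally obtain C where C: "C \<ge> 0" "dual_norm sc M f = ennreal C"
    by (metis ennreal_cases ennreal_less_top leD)
  \<comment> \<open>Each extension takes the value \<open>f x\<close> at the embedded point, which
    has norm 1; so the infimum over extensions is at least \<open>cmod (f x)\<close>.\<close>
  have unit: "cmod (f x) \<le> C" if "M x = 1" for x
  proof -
    have "ennreal (cmod (f x)) \<le> dual_norm sc M f"
      unfolding dual_norm_def
    proof (rule INF_greatest)
      fix G assume G: "G \<in> dual_extensions sc M f"
      show "ennreal (cmod (f x)) \<le>
          (SUP K\<in>{K \<in> completion M. completion_norm M K \<le> 1}. ennreal (cmod (G K)))"
        using that by (intro SUP_upper2[of "completion_embed M x"])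
          (auto simp: F_embed[OF G] completion_embed_in completion_norm_embed)
    qed
    then show ?thesis using C by simp
  qed
  have "cmod (f x) \<le> C * M x" for x
  proof (cases "x = 0")
    case True
    then show ?thesis using f_scale[of 0 x] M_eq_0[of x] by simp
  next
    case False
    then have pos: "M x > 0" using M_nonneg[of x] M_eq_0[of x] by simp
    then have "M (sc (of_real (1 / M x)) x) = 1" by (simp add: M_scale norm_divide)
    from unit[OF this] show ?thesis
      using pos by (simp add: f_scale norm_divide norm_mult field_simps)
  qed
  then show ?thesis using that C f_add f_scale by (auto simp: bounded_functional_def)
qed

lemma dual_norm_less_top: "dual_norm sc M f < top \<Longrightarrow> f \<in> banach_dual sc M"
  by (cases "dual_extensions sc M f = {}") (auto simp: banach_dual_def dual_norm_def)

text \<open>Used to carry estimates between dual norms back to the norms, and to see that the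
  functionals bounded at a single level separate points.\<close>

lemma norming_functional:
  obtains f where "bounded_functional sc M 1 f" "f x = of_real (M x)"
proof -
  interpret complex_subspace sc UNIV by unfold_locales simp
  show ?thesis
  proof (rule hahn_banach[of M x])
    fix f assume "\<And>x y. x \<in> UNIV \<Longrightarrow> y \<in> UNIV \<Longrightarrow> f (x + y) = f x + f y"
      "\<And>c x. x \<in> UNIV \<Longrightarrow> f (sc c x) = c * f x" "\<And>x. x \<in> UNIV \<Longrightarrow> cmod (f x) \<le> M x"
      "f x = of_real (M x)"
    then show thesis by (intro that[of f]) (auto simp: bounded_functional_def)
  qed (auto simp: M_triangle M_scale)
qed

end

section \<open>Linear operations on bounded functionals, and the Neumann series\<close>

lemma bounded_functional_zero: "C \<ge> 0 \<Longrightarrow> (\<And>x. 0 \<le> M x) \<Longrightarrow> bounded_functional sc M C 0"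
  by (simp add: bounded_functional_def)

lemma bounded_functional_add:
  "bounded_functional sc M C f \<Longrightarrow> bounded_functional sc M D g \<Longrightarrow>
    bounded_functional sc M (C + D) (f + g)"
  unfolding bounded_functional_def
  by (auto simp: algebra_simps intro!: order_trans[OF norm_triangle_ineq] add_mono)

lemma bounded_functional_scale:
  "bounded_functional sc M C f \<Longrightarrow> bounded_functional sc M (cmod c * C) (\<lambda>x. c * f x)"
  by (auto simp: bounded_functional_def distrib_left norm_mult mult.assoc mult.left_commute[of _ c]
      intro!: mult_left_mono)

lemma bounded_functional_minus:
  "bounded_functional sc M C f \<Longrightarrow> bounded_functional sc M C (- f)"
  by (auto simp: bounded_functional_def)

lemma bounded_functional_sub:
  "bounded_functional sc M C f \<Longrightarrow> bounded_functional sc M D g \<Longrightarrow>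
    bounded_functional sc M (C + D) (f - g)"
  using bounded_functional_add[OF _ bounded_functional_minus] by fastforce

lemma bounded_functional_mono:
  "bounded_functional sc M C f \<Longrightarrow> C \<le> D \<Longrightarrow> (\<And>x. 0 \<le> M x) \<Longrightarrow> bounded_functional sc M D f"
  unfolding bounded_functional_def by (meson mult_right_mono order_trans)

text \<open>The series is summed pointwise in the complex numbers. \<open>T\<close> is never
  interchanged with the infinite sum: additivity peels off one term at a time, and the bound on
  \<open>T\<close> makes the remainder vanish in the limit.\<close>

lemma neumann_series:
  fixes T :: "('v::ab_group_add \<Rightarrow> complex) \<Rightarrow> 'v \<Rightarrow> complex"
  assumes M: "\<And>x. 0 \<le> M x"
    and T_add: "\<And>f g C D. bounded_functional sc M C f \<Longrightarrow> bounded_functional sc M D g \<Longrightarrow>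
      C \<ge> 0 \<Longrightarrow> D \<ge> 0 \<Longrightarrow> T (f + g) = T f + T g"
    and T_bound: "\<And>f C. bounded_functional sc M C f \<Longrightarrow> C \<ge> 0 \<Longrightarrow> bounded_functional sc M (k * C) (T f)"
    and k: "0 \<le> k" "k < 1"
    and y: "bounded_functional sc M C y" "C \<ge> 0"
  obtains s where "bounded_functional sc M (C / (1 - k)) s" "s - T s = y"
proof -
  define b where "b n = (T ^^ n) y" for n
  have b_bound: "bounded_functional sc M (k ^ n * C) (b n)" for n
  proof (induction n)
    case (Suc n)
    then have "bounded_functional sc M (k * (k ^ n * C)) (T (b n))"
      using k y by (intro T_bound) auto
    then show ?case by (simp add: b_def mult.assoc)
  qed (use y in \<open>simp add: b_def\<close>)
  have b_le: "cmod (b n x) \<le> C * M x * k ^ n" for n x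
    using b_bound[of n] by (simp add: bounded_functional_def mult_ac)
  have geo: "summable (\<lambda>n. C * M x * k ^ n)" for x
    using k by (intro summable_mult summable_geometric) auto
  have sumn: "summable (\<lambda>n. cmod (b n x))" for x
    by (rule summable_comparison_test'[OF geo]) (use b_le in auto)
  then have sums: "summable (\<lambda>n. b n x)" for x by (rule summable_norm_cancel)
  have shift: "summable (\<lambda>n. b (n + m) x)" for m x
    using sums[of x] by (subst summable_iff_shift)
  define R where "R m x = (\<Sum>n. b (n + m) x)" for m x
  have R_bound: "bounded_functional sc M (C / (1 - k) * k ^ m) (R m)" for m
    unfolding bounded_functional_def
  proof (intro conjI allI)
    fix x y
    have "b (n + m) (x + y) = b (n + m) x + b (n + m) y" for n
      using b_bound[of "n + m"] by (simp add: bounded_functional_def)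
    then show "R m (x + y) = R m x + R m y"
      using shift by (simp add: R_def suminf_add)
  next
    fix c x
    have "b (n + m) (sc c x) = c * b (n + m) x" for n
      using b_bound[of "n + m"] by (simp add: bounded_functional_def)
    then show "R m (sc c x) = c * R m x"
      using shift by (simp add: R_def suminf_mult)
  next
    fix x
    have "cmod (R m x) \<le> (\<Sum>n. C * M x * k ^ (n + m))"
      unfolding R_def
    proof (rule order_trans[OF summable_norm suminf_le])
      show "summable (\<lambda>n. C * M x * k ^ (n + m))" using geo by (subst summable_iff_shift)
      show "summable (\<lambda>n. cmod (b (n + m) x))" using sumn by (subst summable_iff_shift)
      then show "summable (\<lambda>n. cmod (b (n + m) x))" .
    qed (rule b_le)
    also have "\<dots> = (\<Sum>n. C * M x * k ^ m * k ^ n)"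
      by (simp add: power_add mult_ac)
    also have "\<dots> = C * M x * k ^ m * (\<Sum>n. k ^ n)"
      using k by (intro suminf_mult summable_geometric) simp
    also have "\<dots> = C / (1 - k) * k ^ m * M x"
      using k by (simp add: suminf_geometric)
    finally show "cmod (R m x) \<le> C / (1 - k) * k ^ m * M x" .
  qed
  have C': "C / (1 - k) * k ^ m \<ge> 0" for m using k y by simp
  define s where "s = R 0"
  have step: "R m = b m + R (Suc m)" for m
    using suminf_split_head[OF shift] by (simp add: R_def fun_eq_iff)
  \<comment> \<open>The left side does not depend on \<open>m\<close>, while both tails on the right
    decay geometrically.\<close>
  have partial: "s - T s - y = R (Suc m) - T (R m)" for m
  proof (induction m)
    case 0
    show ?case using step[of 0] by (simp add: s_def b_def algebra_simps)
  next
    case (Suc m)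
    have "T (R m) = T (b m) + T (R (Suc m))"
      unfolding step[of m]
      by (rule T_add[OF b_bound R_bound]) (use C' k y in auto)
    moreover have "T (b m) = b (Suc m)" by (simp add: b_def)
    moreover have "R (Suc m) x = b (Suc m) x + R (Suc (Suc m)) x" for x
      using fun_cong[OF step[of "Suc m"]] by simp
    moreover define t where "t = T (R (Suc m))"
    ultimately show ?case unfolding Suc.IH t_def[symmetric] by (intro ext) simp
  qed
  have "s - T s = y"
  proof
    fix x
    \<comment> \<open>Each of the two tails contributes
      \<open>C / (1 - k) * k ^ Suc m\<close>.\<close>
    have "cmod ((s - T s - y) x) \<le> 2 * (C / (1 - k)) * M x * k * k ^ m" for m
    proof -
      have "bounded_functional sc M (C / (1 - k) * k ^ Suc m + k * (C / (1 - k) * k ^ m))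
          (R (Suc m) - T (R m))"
        by (intro bounded_functional_sub T_bound R_bound C')
      then show ?thesis
        unfolding partial[of m] by (simp add: bounded_functional_def algebra_simps)
    qed
    moreover have "(\<lambda>m. 2 * (C / (1 - k)) * M x * k * k ^ m) \<longlonglongrightarrow> 0"
      using k by (intro tendsto_mult_right_zero LIMSEQ_realpow_zero)
    ultimately have "cmod ((s - T s - y) x) \<le> 0"
      by (intro LIMSEQ_le_const) auto
    then show "(s - T s) x = y x" by simp
  qed
  then show ?thesis using that[of s] R_bound[of 0] by (simp add: s_def)
qed

section \<open>The dual of a countably normed space\<close>

lemma topspace_strong_dual_topology:
  "topspace (strong_dual_topology sc T) = continuous_dual sc T"
proof -
  have "f \<in> \<Union> {{g \<in> continuous_dual sc T. (SUP x\<in>B. ennreal (cmod (g x - f x))) < ennreal e} | f B e.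
        f \<in> continuous_dual sc T \<and> tvs_bounded sc T B \<and> 0 < e}" if f: "f \<in> continuous_dual sc T" for f
  proof (rule UnionI)
    \<comment> \<open>With \<open>B = {}\<close> the supremum is 0, so this generating set is the
      whole dual.\<close>
    show "f \<in> {g \<in> continuous_dual sc T. (SUP x\<in>{}. ennreal (cmod (g x - f x))) < ennreal 1}"
      using f by (simp add: bot_ennreal)
    have "tvs_bounded sc T {}" by (auto simp: tvs_bounded_def intro: exI[of _ 1])
    then show "{g \<in> continuous_dual sc T. (SUP x\<in>{}. ennreal (cmod (g x - f x))) < ennreal 1} \<in>
        {{g \<in> continuous_dual sc T. (SUP x\<in>B. ennreal (cmod (g x - f x))) < ennreal e} | f B e.
        f \<in> continuous_dual sc T \<and> tvs_bounded sc T B \<and> 0 < e}"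
      using f zero_less_one by blast
  qed
  then show ?thesis by (auto simp: strong_dual_topology_def)
qed

context countably_normed_space
begin

section \<open>The dual as an increasing union of levels\<close>

sublocale level: complex_normed sc "N p" for p
  by unfold_locales (rule norms)

lemma bounded_functional_level_mono:
  assumes "bounded_functional sc (N p) C f" "C \<ge> 0" "p \<le> q"
  shows "bounded_functional sc (N q) C f"
  using assms norms_mono[OF \<open>p \<le> q\<close>]
  unfolding bounded_functional_def by (meson mult_left_mono order_trans)

lemma cn_dual_iff: "f \<in> cn_dual sc N \<longleftrightarrow> (\<exists>p. \<exists>C\<ge>0. bounded_functional sc (N p) C f)"
  unfolding cn_dual_def
  by (blast elim: level.banach_dual_bounded_functional intro: level.bounded_functional_banach_dual)

lemma cn_dualI: "bounded_functional sc (N p) C f \<Longrightarrow> C \<ge> 0 \<Longrightarrow> f \<in> cn_dual sc N"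
  by (auto simp: cn_dual_iff)

lemma cn_dualE2:
  assumes "f \<in> cn_dual sc N" "g \<in> cn_dual sc N"
  obtains p C D where "C \<ge> 0" "D \<ge> 0" "bounded_functional sc (N p) C f" "bounded_functional sc (N p) D g"
proof -
  obtain p C q D where "C \<ge> 0" "D \<ge> 0" "bounded_functional sc (N p) C f" "bounded_functional sc (N q) D g"
    using assms by (auto simp: cn_dual_iff)
  then show ?thesis
    by (intro that[of C D "max p q"]) (auto intro: bounded_functional_level_mono)
qed

lemma cn_dual_add: "f \<in> cn_dual sc N \<Longrightarrow> g \<in> cn_dual sc N \<Longrightarrow> f + g \<in> cn_dual sc N"
  by (erule (1) cn_dualE2) (auto intro: cn_dualI bounded_functional_add)

lemma cn_dual_diff: "f \<in> cn_dual sc N \<Longrightarrow> g \<in> cn_dual sc N \<Longrightarrow> f - g \<in> cn_dual sc N"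
  by (erule (1) cn_dualE2) (auto intro: cn_dualI bounded_functional_sub)

lemma cn_dual_scale:
  assumes "f \<in> cn_dual sc N"
  shows "(\<lambda>x. c * f x) \<in> cn_dual sc N"
proof -
  obtain p C where "C \<ge> 0" "bounded_functional sc (N p) C f"
    using assms by (auto simp: cn_dual_iff)
  then show ?thesis by (intro cn_dualI[OF bounded_functional_scale]) auto
qed

lemma cn_dual_zero: "0 \<in> cn_dual sc N"
  using cn_dualI[OF bounded_functional_zero[of 0]] level.M_nonneg by fastforce

section \<open>Continuity, bounded sets and reflexivity\<close>

lemma topspace_cn_topology: "topspace (cn_topology N) = UNIV"
proof -
  have "x \<in> {y. N 0 (y - x) < 1}" for x by simp
  then show ?thesis unfolding cn_topology_def topology_generated_by_topspace
    using zero_less_one by blast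
qed

text \<open>Since the norms increase with the level, finitely many of them are dominated by one, and
  a ball of that norm fits into an intersection of balls. Recentring a ball at \<open>x\<close>
  costs the distance to its centre.\<close>

lemma openin_cn_topology_ball:
  assumes "openin (cn_topology N) U" "x \<in> U"
  obtains p e where "e > 0" "{y. N p (y - x) < e} \<subseteq> U"
proof -
  have "generate_topology_on {{y. N p (y - x) < e} | p x e. 0 < e} U"
    using assms(1) by (simp add: cn_topology_def openin_topology_generated_by_iff)
  then have "\<exists>p. \<exists>e>0. {y. N p (y - x) < e} \<subseteq> U" using assms(2)
  proof (induction arbitrary: x)
    case (Int a b)
    then have "x \<in> a" "x \<in> b" by auto
    then obtain p e q e' where e: "e > 0" "{y. N p (y - x) < e} \<subseteq> a"
      "e' > 0" "{y. N q (y - x) < e'} \<subseteq> b" using Int.IH by meson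
    have "{y. N (max p q) (y - x) < min e e'} \<subseteq> a \<inter> b"
    proof
      fix y assume "y \<in> {y. N (max p q) (y - x) < min e e'}"
      then have "N p (y - x) < e" "N q (y - x) < e'"
        using norms_mono[of p "max p q" "y - x"] norms_mono[of q "max p q" "y - x"] by auto
      then show "y \<in> a \<inter> b" using e by auto
    qed
    then show ?case using e by (intro exI[of _ "max p q"] exI[of _ "min e e'"]) auto
  next
    case (UN K)
    then obtain k where k: "k \<in> K" "x \<in> k" by auto
    then show ?case using UN.IH[OF k] by blast
  next
    case (Basis s)
    then obtain p z e where s: "s = {y. N p (y - z) < e}" "N p (x - z) < e" by auto
    have "N p (y - z) \<le> N p (y - x) + N p (x - z)" for y
      using level.M_triangle[of p "y - x" "x - z"] by simp
    then have "{y. N p (y - x) < e - N p (x - z)} \<subseteq> s"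
      unfolding s(1) by (auto intro: le_less_trans simp: less_diff_eq)
    then show ?case using s by (intro exI[of _ p] exI[of _ "e - N p (x - z)"]) auto
  qed auto
  then show ?thesis using that by blast
qed

lemma bounded_functionalI_ball:
  assumes "\<And>x y. f (x + y) = f x + f y" "\<And>c x. f (sc c x) = c * f x"
    and C: "C > 0" and r: "r > 0" and ball: "\<And>x. N p x < r \<Longrightarrow> cmod (f x) \<le> C"
  shows "bounded_functional sc (N p) (2 * C / r) f"
  unfolding bounded_functional_def
proof (intro conjI allI)
  fix x
  show "cmod (f x) \<le> 2 * C / r * N p x"
  proof (cases "x = 0")
    case True
    then show ?thesis using assms(2)[of 0 0] by simp
  next
    case False
    then have pos: "N p x > 0" using level.M_nonneg[of p x] level.M_eq_0[of p x] by simp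
    \<comment> \<open>This scales \<open>x\<close> to norm \<open>r / 2\<close>, inside the open
      ball; hence the factor 2 in the constant.\<close>
    define t where "t = r / (2 * N p x)"
    have t: "t > 0" using pos r by (simp add: t_def)
    have "N p (sc (of_real t) x) = r / 2"
      using pos r by (simp add: level.M_scale t_def norm_divide norm_mult)
    then have "cmod (f (sc (of_real t) x)) \<le> C" using r by (intro ball) simp
    then have "t * cmod (f x) \<le> C" using t by (simp add: assms norm_mult)
    then show ?thesis using pos r by (simp add: t_def field_simps)
  qed
qed (use assms in auto)

lemma continuous_dual_cn_topology: "continuous_dual sc (cn_topology N) = cn_dual sc N"
proof (intro equalityI subsetI)
  fix f assume "f \<in> continuous_dual sc (cn_topology N)"
  then have f: "\<And>x y. f (x + y) = f x + f y" "\<And>c x. f (sc c x) = c * f x"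
    and cont: "continuous_map (cn_topology N) euclidean f"
    by (auto simp: continuous_dual_def topspace_cn_topology)
  have f0: "f 0 = 0" using f(2)[of 0 0] by simp
  \<comment> \<open>This neighbourhood of 0 contains a ball of a single norm, and that norm provides
    the level at which \<open>f\<close> is bounded.\<close>
  have "openin (cn_topology N) {x. f x \<in> ball 0 1}"
    using openin_continuous_map_preimage[OF cont, of "ball 0 1"] by (simp add: topspace_cn_topology)
  moreover have "0 \<in> {x. f x \<in> ball 0 1}" by (simp add: f0)
  ultimately obtain p e where e: "e > 0" and sub: "{y. N p (y - 0) < e} \<subseteq> {x. f x \<in> ball 0 1}"
    by (rule openin_cn_topology_ball)
  have "cmod (f x) \<le> 1" if "N p x < e" for x
    using sub that by (auto simp: subset_iff dist_norm less_imp_le)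
  then have "bounded_functional sc (N p) (2 * 1 / e) f"
    using e f by (intro bounded_functionalI_ball) auto
  then show "f \<in> cn_dual sc N" using e by (intro cn_dualI) auto
next
  fix f assume "f \<in> cn_dual sc N"
  then obtain p C where C: "C \<ge> 0" and f: "bounded_functional sc (N p) C f" by (auto simp: cn_dual_iff)
  have "continuous_map (cn_topology N) euclidean f"
    unfolding continuous_map_def
  proof (intro conjI allI impI)
    fix V :: "complex set" assume "openin euclidean V"
    then have V: "open V" by simp
    show "openin (cn_topology N) {x \<in> topspace (cn_topology N). f x \<in> V}"
    proof (subst openin_subopen, intro ballI)
      fix x assume "x \<in> {x \<in> topspace (cn_topology N). f x \<in> V}"
      then have "f x \<in> V" by simp
      then obtain e where e: "e > 0" "ball (f x) e \<subseteq> V" using V open_contains_ball by blast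
      \<comment> \<open>\<open>C + 1\<close> keeps the radius meaningful when
        \<open>C = 0\<close>.\<close>
      define U where "U = {y. N p (y - x) < e / (C + 1)}"
      have e': "e / (C + 1) > 0" using e C by simp
      then have "openin (cn_topology N) U"
        unfolding cn_topology_def U_def by (intro topology_generated_by_Basis) blast
      moreover have "x \<in> U" using e' by (simp add: U_def)
      moreover have "f y \<in> V" if "y \<in> U" for y
      proof -
        have "dist (f x) (f y) = cmod (f (y - x))"
          by (simp add: dist_norm norm_minus_commute level.bounded_functional_diff[OF f])
        also have "\<dots> \<le> C * N p (y - x)" using f by (simp add: bounded_functional_def)
        also have "\<dots> \<le> (C + 1) * N p (y - x)"
          using level.M_nonneg by (intro mult_right_mono) auto
        also have "\<dots> < e" using that C by (simp add: U_def field_simps)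
        finally show ?thesis using e by auto
      qed
      ultimately show "\<exists>T. openin (cn_topology N) T \<and> x \<in> T \<and>
          T \<subseteq> {x \<in> topspace (cn_topology N). f x \<in> V}"
        by (auto simp: topspace_cn_topology)
    qed
  qed auto
  then show "f \<in> continuous_dual sc (cn_topology N)"
    using f by (simp add: continuous_dual_def topspace_cn_topology bounded_functional_def)
qed

text \<open>The hypothesis says that \<open>N r\<close> dominates every norm up to a constant, so
  the space is normable by \<open>N r\<close>.\<close>

lemma unit_ball_tvs_bounded:
  assumes "\<And>n. \<exists>K. \<forall>x. N n x \<le> K * N r x"
  shows "tvs_bounded sc (cn_topology N) {x. N r x \<le> 1}"
  unfolding tvs_bounded_def topspace_cn_topology
proof (intro conjI allI impI)
  fix U assume U: "openin (cn_topology N) U \<and> 0 \<in> U"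
  then obtain n e where e: "e > 0" and sub: "{y. N n (y - 0) < e} \<subseteq> U"
    using openin_cn_topology_ball[of U 0] by blast
  obtain K where K: "\<And>x. N n x \<le> K * N r x" using assms by blast
  define \<rho> where "\<rho> = (\<bar>K\<bar> + 1) / e"
  have \<rho>: "\<rho> > 0" using e by (simp add: \<rho>_def)
  have "{x. N r x \<le> 1} \<subseteq> sc c ` U" if c: "\<rho> \<le> cmod c" for c
  proof
    fix x assume "x \<in> {x. N r x \<le> 1}"
    then have x: "N r x \<le> 1" by simp
    have "K * N r x \<le> \<bar>K\<bar> * 1" using x level.M_nonneg by (intro mult_mono) auto
    then have "N n x \<le> \<bar>K\<bar>" using K[of x] by simp
    also have "\<dots> < e * cmod c" using c e by (simp add: \<rho>_def field_simps)
    finally have "N n (sc (1 / c) x) < e"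
      using c \<rho> e by (simp add: level.M_scale norm_divide divide_less_eq)
    then have "sc (1 / c) x \<in> U" using sub by auto
    moreover have "x = sc c (sc (1 / c) x)" using c \<rho> by auto
    ultimately show "x \<in> sc c ` U" by (rule rev_image_eqI)
  qed
  then show "\<exists>\<rho>>0. \<forall>c. \<rho> \<le> cmod c \<longrightarrow> {x. N r x \<le> 1} \<subseteq> sc c ` U"
    using \<rho> by blast
qed auto

text \<open>As the unit ball of \<open>N r\<close> is bounded, balls of the dual norm at level
  \<open>r\<close> are strong neighbourhoods. Thus \<open>g\<close> is strongly continuous, and
  surjectivity of the canonical map into the bidual provides the point.\<close>

lemma reflexive_evaluation:
  assumes refl: "reflexive_tvs sc (cn_topology N)"
    and N_le: "\<And>n. \<exists>K. \<forall>x. N n x \<le> K * N r x"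
    and g_add: "\<And>f h. f \<in> cn_dual sc N \<Longrightarrow> h \<in> cn_dual sc N \<Longrightarrow> g (f + h) = g f + g h"
    and g_scale: "\<And>c f. f \<in> cn_dual sc N \<Longrightarrow> g (\<lambda>x. c * f x) = c * g f"
    and g_bound: "\<And>f C. bounded_functional sc (N r) C f \<Longrightarrow> C \<ge> 0 \<Longrightarrow> cmod (g f) \<le> C"
  obtains x where "\<And>f. f \<in> cn_dual sc N \<Longrightarrow> g f = f x"
proof -
  let ?T = "cn_topology N"
  let ?S = "strong_dual_topology sc ?T"
  let ?msc = "\<lambda>c (f :: 'v \<Rightarrow> complex) x. c * f x"
  let ?g = "restrict g (cn_dual sc N)"
  have top: "topspace ?S = cn_dual sc N"
    by (simp add: topspace_strong_dual_topology continuous_dual_cn_topology)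
  have cont: "continuous_map ?S euclidean ?g"
    unfolding continuous_map_def
  proof (intro conjI allI impI)
    fix V :: "complex set" assume "openin euclidean V"
    then have V: "open V" by simp
    show "openin ?S {f \<in> topspace ?S. ?g f \<in> V}"
    proof (subst openin_subopen, intro ballI)
      fix f assume "f \<in> {f \<in> topspace ?S. ?g f \<in> V}"
      then have f: "f \<in> cn_dual sc N" and gf: "g f \<in> V" by (auto simp: top)
      obtain e where e: "e > 0" "ball (g f) e \<subseteq> V" using V gf open_contains_ball by blast
      \<comment> \<open>The radius is \<open>e / 3\<close> because passing from the ball to a global
        bound doubles the constant, and \<open>2 * (e / 3) < e\<close>.\<close>
      define W where "W = {h \<in> cn_dual sc N.
        (SUP x\<in>{x. N r x \<le> 1}. ennreal (cmod (h x - f x))) < ennreal (e / 3)}"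
      have "openin ?S W"
        unfolding strong_dual_topology_def W_def continuous_dual_cn_topology
      proof (rule topology_generated_by_Basis, intro CollectI exI[of _ f] exI[of _ "{x. N r x \<le> 1}"]
            exI[of _ "e / 3"] conjI refl)
        show "tvs_bounded sc ?T {x. N r x \<le> 1}" by (rule unit_ball_tvs_bounded[OF N_le])
      qed (use e f in auto)
      moreover have "f \<in> W" using f e by (simp add: W_def SUP_constant bot_ennreal)
      moreover have "g h \<in> V" if "h \<in> W" for h
      proof -
        have h: "h \<in> cn_dual sc N"
          and lt: "(SUP x\<in>{x. N r x \<le> 1}. ennreal (cmod (h x - f x))) < ennreal (e / 3)"
          using that by (auto simp: W_def)
        have hf: "h - f \<in> cn_dual sc N" using h f by (rule cn_dual_diff)
        then obtain p C where lin: "bounded_functional sc (N p) C (h - f)"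
          by (auto simp: cn_dual_iff)
        have "bounded_functional sc (N r) (2 * (e / 3) / 1) (h - f)"
        proof (rule bounded_functionalI_ball)
          fix x assume "N r x < 1"
          then have "ennreal (cmod (h x - f x)) \<le> (SUP x\<in>{x. N r x \<le> 1}. ennreal (cmod (h x - f x)))"
            by (intro SUP_upper) auto
          then have "ennreal (cmod (h x - f x)) \<le> ennreal (e / 3)" using lt by simp
          then show "cmod ((h - f) x) \<le> e / 3" using e by (subst (asm) ennreal_le_iff) auto
        qed (use lin e in \<open>auto simp: bounded_functional_def\<close>)
        then have "cmod (g (h - f)) \<le> 2 * (e / 3) / 1" using e by (intro g_bound) auto
        moreover have "g h = g (h - f) + g f" using g_add[OF hf f] by simp
        ultimately have "dist (g f) (g h) < e" using e by (simp add: dist_norm norm_minus_commute)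
        then show ?thesis using e by auto
      qed
      ultimately show "\<exists>U. openin ?S U \<and> f \<in> U \<and> U \<subseteq> {f \<in> topspace ?S. ?g f \<in> V}"
        by (intro exI[of _ W]) (auto simp: top W_def)
    qed
  qed auto
  have "?g \<in> continuous_dual ?msc ?S"
    using cont by (auto simp: continuous_dual_def top g_add g_scale cn_dual_add cn_dual_scale)
  then have "?g \<in> topspace (strong_dual_topology ?msc ?S)"
    by (simp add: topspace_strong_dual_topology)
  also have "topspace (strong_dual_topology ?msc ?S) = (\<lambda>x. \<lambda>f\<in>continuous_dual sc ?T. f x) ` topspace ?T"
    using homeomorphic_imp_surjective_map[OF refl[unfolded reflexive_tvs_def]] by simp
  finally obtain x where "?g = (\<lambda>f\<in>cn_dual sc N. f x)"
    unfolding continuous_dual_cn_topology by (rule imageE)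
  then have "g f = f x" if "f \<in> cn_dual sc N" for f
    using that by (metis restrict_apply')
  then show ?thesis by (rule that)
qed

end

section \<open>Multiplication and the unit\<close>

lemma vector_space_functionals: "vector_space (\<lambda>c (f :: 'v \<Rightarrow> complex) x. c * f x)"
  by unfold_locales (auto simp: fun_eq_iff algebra_simps)

section \<open>Product estimates across levels\<close>

context strong_algebra
begin

text \<open>The dual norm is infinite off the Banach dual, so a finite bound on it also yields that
  the product belongs to level \<open>p\<close>.\<close>

lemma bounded_functional_of_dual_norm_le:
  assumes pq: "real p > real q + d"
    and a: "bounded_functional sc (N q) C a" "C \<ge> 0"
    and b: "bounded_functional sc (N p) D b" "D \<ge> 0"
    and le: "dual_norm sc (N p) c \<le> ennreal (A p q) * dual_norm sc (N q) a * dual_norm sc (N p) b"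
  shows "bounded_functional sc (N p) (A p q * C * D) c"
proof -
  have "dual_norm sc (N p) c \<le> ennreal (A p q) * ennreal C * ennreal D"
    using level.bounded_functional_banach_dual(2)[OF a] level.bounded_functional_banach_dual(2)[OF b]
    by (intro order_trans[OF le] mult_mono) auto
  also have "\<dots> = ennreal (A p q * C * D)"
    using A_pos[OF pq] a b by (simp add: ennreal_mult)
  finally have le: "dual_norm sc (N p) c \<le> ennreal (A p q * C * D)" .
  then have "c \<in> banach_dual sc (N p)"
    by (intro level.dual_norm_less_top) (auto intro: le_less_trans)
  then obtain B where "B \<ge> 0" "dual_norm sc (N p) c = ennreal B" "bounded_functional sc (N p) B c"
    by (rule level.banach_dual_bounded_functional)
  then show ?thesis
    using le A_pos[OF pq] a b level.M_nonneg by (auto intro: bounded_functional_mono)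
qed

lemma mul_left_bound:
  assumes "real p > real q + d"
    and "bounded_functional sc (N q) C a" "C \<ge> 0"
    and "bounded_functional sc (N p) D b" "D \<ge> 0"
  shows "bounded_functional sc (N p) (A p q * C * D) (mul a b)"
  using assms level.bounded_functional_banach_dual(1)
  by (intro bounded_functional_of_dual_norm_le[OF assms] norm_mul_left) blast+

lemma mul_right_bound:
  assumes "real p > real q + d"
    and "bounded_functional sc (N q) C a" "C \<ge> 0"
    and "bounded_functional sc (N p) D b" "D \<ge> 0"
  shows "bounded_functional sc (N p) (A p q * C * D) (mul b a)"
  using assms level.bounded_functional_banach_dual(1)
  by (intro bounded_functional_of_dual_norm_le[OF assms] norm_mul_right) blast+

lemma mul_diff_left:
  assumes "a \<in> cn_dual sc N" "b \<in> cn_dual sc N" "c \<in> cn_dual sc N"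
  shows "mul (a - b) c = mul a c - mul b c"
  using mul_add_left[OF cn_dual_diff[OF assms(1,2)] assms(2,3)] by (simp add: algebra_simps)

lemma mul_diff_right:
  assumes "a \<in> cn_dual sc N" "b \<in> cn_dual sc N" "c \<in> cn_dual sc N"
  shows "mul a (b - c) = mul a b - mul a c"
  using mul_add_right[OF assms(1) cn_dual_diff[OF assms(2,3)] assms(3)] by (simp add: algebra_simps)

text \<open>Left multiplication by \<open>c\<close> contracts level \<open>p\<close> with factor
  \<open>A p q * C\<close>, although \<open>c\<close> itself is only known to be bounded at level
  \<open>q\<close>.\<close>

lemma neumann_left:
  assumes "real p > real q + d"
    and c: "bounded_functional sc (N q) C c" "C \<ge> 0" "A p q * C < 1"
    and y: "bounded_functional sc (N p) D y" "D \<ge> 0"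
  obtains s E where "E \<ge> 0" "bounded_functional sc (N p) E s" "s - mul c s = y"
proof (rule neumann_series[where T = "mul c" and k = "A p q * C" and y = y and M = "N p"])
  fix f g E F assume "bounded_functional sc (N p) E f" "bounded_functional sc (N p) F g" "E \<ge> 0" "F \<ge> 0"
  then show "mul c (f + g) = mul c f + mul c g"
    using c by (intro mul_add_right) (auto intro: cn_dualI)
next
  fix s assume "bounded_functional sc (N p) (D / (1 - A p q * C)) s" "s - mul c s = y"
  then show thesis using that[of "D / (1 - A p q * C)" s] c y by simp
qed (use assms mul_left_bound A_pos[OF assms(1)] level.M_nonneg in auto)

lemma neumann_right:
  assumes "real p > real q + d"
    and c: "bounded_functional sc (N q) C c" "C \<ge> 0" "A p q * C < 1"
    and y: "bounded_functional sc (N p) D y" "D \<ge> 0"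
  obtains s E where "E \<ge> 0" "bounded_functional sc (N p) E s" "s - mul s c = y"
proof (rule neumann_series[where T = "\<lambda>s. mul s c" and k = "A p q * C" and y = y and M = "N p"])
  fix f g E F assume "bounded_functional sc (N p) E f" "bounded_functional sc (N p) F g" "E \<ge> 0" "F \<ge> 0"
  then show "mul (f + g) c = mul f c + mul g c"
    using c by (intro mul_add_left) (auto intro: cn_dualI)
next
  fix s assume "bounded_functional sc (N p) (D / (1 - A p q * C)) s" "s - mul s c = y"
  then show thesis using that[of "D / (1 - A p q * C)" s] c y by simp
qed (use assms mul_right_bound A_pos[OF assms(1)] level.M_nonneg in auto)

end

section \<open>Descent of the unit to all levels when \<open>d < - 1\<close>\<close>

context unital_strong_algebra
begin

text \<open>For \<open>d < - 1\<close> the pair of levels \<open>n\<close> and \<open>Suc n\<close>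
  is admissible. Writing \<open>f = mul f unit\<close> with \<open>unit\<close> bounded at level
  \<open>n\<close> lowers \<open>f\<close> from level \<open>Suc n\<close> to \<open>n\<close>;
  iteration reaches \<open>r\<close>.\<close>

lemma bounded_at_unit_level:
  assumes d: "d < - 1"
    and u: "bounded_functional sc (N r) U unit" "U \<ge> 0"
    and "n \<ge> r"
  shows "\<exists>K\<ge>0. \<forall>f C. C \<ge> 0 \<longrightarrow> bounded_functional sc (N n) C f \<longrightarrow> bounded_functional sc (N r) (K * C) f"
  using \<open>n \<ge> r\<close>
proof (induction n rule: dec_induct)
  case base
  then show ?case by (intro exI[of _ 1]) auto
next
  case (step n)
  then obtain K where K: "K \<ge> 0" "\<And>f C. C \<ge> 0 \<Longrightarrow> bounded_functional sc (N n) C f \<Longrightarrow>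
    bounded_functional sc (N r) (K * C) f" by blast
  have nd: "real n > real (Suc n) + d" using d by simp
  have un: "bounded_functional sc (N n) U unit"
    using u step by (auto intro: bounded_functional_level_mono)
  have "bounded_functional sc (N r) (K * A n (Suc n) * U * C) f"
    if f: "C \<ge> 0" "bounded_functional sc (N (Suc n)) C f" for C f
  proof -
    have "bounded_functional sc (N n) (A n (Suc n) * C * U) (mul f unit)"
      using f un u by (intro mul_left_bound nd)
    also have "mul f unit = f" using f by (intro unit_right cn_dualI)
    finally have "bounded_functional sc (N r) (K * (A n (Suc n) * C * U)) f"
      using A_pos[OF nd] f u by (intro K) auto
    then show ?thesis by (simp add: mult_ac)
  qed
  then show ?case using K A_pos[OF nd] u by (intro exI[of _ "K * A n (Suc n) * U"]) auto
qed

text \<open>The functionals bounded at level \<open>p\<close> separate points, so they are weak-* dense;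
  reflexivity makes them norm dense.\<close>

lemma unit_approximable:
  assumes d: "d < - 1"
    and u: "bounded_functional sc (N r) U unit" "U \<ge> 0"
    and e: "e > 0"
  obtains v C where "C \<ge> 0" "bounded_functional sc (N p) C v" "bounded_functional sc (N r) e (unit - v)"
proof (rule ccontr)
  assume "\<not> thesis"
  with that have far: "\<not> bounded_functional sc (N r) e (unit - v)"
    if "bounded_functional sc (N p) C v" "C \<ge> 0" for v C
    using that by blast
  let ?D = "cn_dual sc N"
  let ?msc = "\<lambda>c (f :: 'v \<Rightarrow> complex) x. c * f x"
  interpret fs: vector_space ?msc by (rule vector_space_functionals)
  interpret dual: complex_subspace ?msc ?D
    by unfold_locales (auto simp: fs.subspace_def cn_dual_add cn_dual_scale cn_dual_zero)
  define F where "F = {f. \<exists>C\<ge>0. bounded_functional sc (N p) C f}"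
  \<comment> \<open>The dual norm at level \<open>r\<close>. It is finite on the whole dual, since
    \<open>at_r\<close> brings every functional down to that level.\<close>
  define \<nu> where "\<nu> f = enn2real (dual_norm sc (N r) f)" for f
  have at_r: "\<exists>C\<ge>0. bounded_functional sc (N r) C f" if f: "f \<in> ?D" for f
  proof -
    obtain n C where C: "C \<ge> 0" "bounded_functional sc (N n) C f"
      using f by (auto simp: cn_dual_iff)
    then have "bounded_functional sc (N (max n r)) C f"
      by (auto intro: bounded_functional_level_mono)
    then show ?thesis
      using bounded_at_unit_level[OF d u, of "max n r"] C(1) by (meson max.cobounded2 mult_nonneg_nonneg)
  qed
  have \<nu>: "bounded_functional sc (N r) (\<nu> f) f" if f: "f \<in> ?D" for f
  proof -
    obtain C where "C \<ge> 0" "bounded_functional sc (N r) C f" using at_r[OF f] by blast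
    then have "f \<in> banach_dual sc (N r)" by (intro level.bounded_functional_banach_dual)
    then show ?thesis
      by (rule level.banach_dual_bounded_functional) (simp add: \<nu>_def)
  qed
  have \<nu>_le: "\<nu> f \<le> C" if "bounded_functional sc (N r) C f" "C \<ge> 0" for f C
    using level.bounded_functional_banach_dual(2)[OF that] that
    by (simp add: \<nu>_def enn2real_leI)
  have \<nu>_nonneg: "0 \<le> \<nu> f" for f by (simp add: \<nu>_def)
  have \<nu>_scale_le: "\<nu> (?msc c f) \<le> cmod c * \<nu> f" if "f \<in> ?D" for c f
    using \<nu>[OF that] \<nu>_nonneg by (intro \<nu>_le bounded_functional_scale) auto
  have \<nu>_scale: "\<nu> (?msc c f) = cmod c * \<nu> f" if f: "f \<in> ?D" for c f
  proof (cases "c = 0")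
    case True
    then show ?thesis using \<nu>_scale_le[OF f, of c] \<nu>_nonneg[of "?msc c f"] by simp
  next
    case False
    then have "\<nu> f \<le> cmod (1 / c) * \<nu> (?msc c f)"
      using \<nu>_scale_le[OF cn_dual_scale[OF f, of c], of "1 / c"] by simp
    then have "cmod c * \<nu> f \<le> \<nu> (?msc c f)" using False by (simp add: norm_divide field_simps)
    then show ?thesis using \<nu>_scale_le[OF f, of c] by simp
  qed
  have F_sub: "fs.subspace F"
    unfolding fs.subspace_def
  proof (intro conjI ballI allI)
    show "0 \<in> F"
      using bounded_functional_zero[of 0 "N p" sc] level.M_nonneg by (auto simp: F_def)
  next
    fix f g assume "f \<in> F" "g \<in> F"
    then obtain C D where "C \<ge> 0" "bounded_functional sc (N p) C f"
      "D \<ge> 0" "bounded_functional sc (N p) D g" by (auto simp: F_def)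
    then show "f + g \<in> F"
      unfolding F_def by (intro CollectI exI[of _ "C + D"]) (auto intro: bounded_functional_add)
  next
    fix c f assume "f \<in> F"
    then obtain C where "C \<ge> 0" "bounded_functional sc (N p) C f" by (auto simp: F_def)
    then show "?msc c f \<in> F"
      unfolding F_def by (intro CollectI exI[of _ "cmod c * C"]) (auto intro: bounded_functional_scale)
  qed
  have F_D: "F \<subseteq> ?D" by (auto simp: F_def intro: cn_dualI)
  have \<nu>_far: "e \<le> \<nu> (unit - v)" if v: "v \<in> F" for v
  proof (rule ccontr)
    assume "\<not> e \<le> \<nu> (unit - v)"
    moreover have "bounded_functional sc (N r) (\<nu> (unit - v)) (unit - v)"
      using v F_D by (intro \<nu> cn_dual_diff unit_closed) auto
    ultimately have "bounded_functional sc (N r) e (unit - v)"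
      using level.M_nonneg by (auto intro: bounded_functional_mono)
    then show False using v far by (auto simp: F_def)
  qed
  \<comment> \<open>A functional norming \<open>x\<close> at level \<open>n\<close> turns the
    comparison of dual norms into one of norms; below \<open>r\<close>, monotonicity
    suffices.\<close>
  have N_le: "\<exists>K. \<forall>x. N n x \<le> K * N r x" for n
  proof (cases "n \<ge> r")
    case True
    then obtain K where K: "\<And>f C. C \<ge> 0 \<Longrightarrow> bounded_functional sc (N n) C f \<Longrightarrow>
        bounded_functional sc (N r) (K * C) f"
      using bounded_at_unit_level[OF d u] by blast
    have "N n x \<le> K * N r x" for x
    proof -
      obtain f where f: "bounded_functional sc (N n) 1 f" "f x = of_real (N n x)"
        by (rule level.norming_functional)
      from K[OF _ f(1)] have "cmod (f x) \<le> K * N r x" by (simp add: bounded_functional_def)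
      then show ?thesis using f level.M_nonneg by simp
    qed
    then show ?thesis by blast
  next
    case False
    then show ?thesis using norms_mono[of n r] by (intro exI[of _ 1]) auto
  qed
  show False
  proof (rule dual.hahn_banach_separation[OF _ _ \<nu>_scale F_sub F_D unit_closed e \<nu>_far])
    show "\<nu> (f + g) \<le> \<nu> f + \<nu> g" if "f \<in> ?D" "g \<in> ?D" for f g
      using that \<nu> \<nu>_nonneg by (intro \<nu>_le bounded_functional_add) auto
  next
    fix g assume g: "\<And>f h. f \<in> ?D \<Longrightarrow> h \<in> ?D \<Longrightarrow> g (f + h) = g f + g h"
      "\<And>c f. f \<in> ?D \<Longrightarrow> g (?msc c f) = c * g f"
      "\<And>f. f \<in> ?D \<Longrightarrow> cmod (g f) \<le> \<nu> f" "\<And>v. v \<in> F \<Longrightarrow> g v = 0" "g unit \<noteq> 0"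
    have "cmod (g f) \<le> C" if "bounded_functional sc (N r) C f" "C \<ge> 0" for f C
      using g(3)[of f] \<nu>_le[OF that] that by (force intro: cn_dualI)
    \<comment> \<open>The separating functional is evaluation at \<open>x\<close>. It annihilates
      all functionals bounded at level \<open>p\<close>, including one that norms \<open>x\<close>,
      so \<open>x = 0\<close> and \<open>g unit = unit 0 = 0\<close>.\<close>
    then obtain x where x: "\<And>f. f \<in> ?D \<Longrightarrow> g f = f x"
      using reflexive_evaluation[OF reflexive N_le g(1,2)] by blast
    obtain f where f: "bounded_functional sc (N p) 1 f" "f x = of_real (N p x)"
      by (rule level.norming_functional)
    then have "f \<in> F" by (auto simp: F_def intro: exI[of _ 1])
    then have "f x = 0" using g(4)[of f] x[of f] F_D by auto
    then have "x = 0" using f level.M_eq_0 by simp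
    then have "unit x = 0" using level.bounded_functional_diff[OF u(1), of 0 0] by simp
    then show False using g(5) x[OF unit_closed] by simp
  qed (rule \<nu>_nonneg)
qed

text \<open>A dense ideal of a unital Banach algebra contains invertible elements, so the unit
  descends level by level.\<close>

lemma unit_bounded_everywhere:
  assumes d: "d < - 1"
  obtains U where "U \<ge> 0" "bounded_functional sc (N p) U unit"
proof -
  define Q where "Q n \<longleftrightarrow> (\<exists>U\<ge>0. bounded_functional sc (N n) U unit)" for n
  define r where "r = (LEAST n. Q n)"
  have "\<exists>n. Q n" using unit_closed by (auto simp: cn_dual_iff Q_def)
  then have "Q r" unfolding r_def by (rule LeastI_ex)
  then obtain U where u: "bounded_functional sc (N r) U unit" "U \<ge> 0" by (auto simp: Q_def)
  have "r = 0"
  proof (rule ccontr)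
    assume "r \<noteq> 0"
    then obtain p where p: "r = Suc p" by (cases r) auto
    have rr: "real r > real r + d" and pr: "real p > real r + d" using d p by auto
    have pos: "A r r > 0" by (rule A_pos[OF rr])
    \<comment> \<open>With this \<open>e\<close>, multiplication by \<open>unit - v\<close>
      contracts level \<open>r\<close> with factor \<open>1 / 2\<close>, so the Neumann series
      provides a right inverse \<open>s\<close> of \<open>v\<close>.\<close>
    define e where "e = 1 / (2 * A r r)"
    have e: "e > 0" "A r r * e < 1" using pos by (auto simp: e_def)
    obtain v C where v: "C \<ge> 0" "bounded_functional sc (N p) C v"
      and w: "bounded_functional sc (N r) e (unit - v)"
      by (rule unit_approximable[OF d u e(1)])
    obtain s E where s: "E \<ge> 0" "bounded_functional sc (N r) E s" "s - mul (unit - v) s = unit"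
      by (rule neumann_left[OF rr w _ e(2) u]) (use e in auto)
    have "mul (unit - v) s = s - mul v s"
      using v s by (simp add: mul_diff_left unit_closed unit_left cn_dualI)
    then have "mul v s = unit" using s(3) by simp
    \<comment> \<open>The factor \<open>v\<close> is bounded at level \<open>p\<close> and
      \<open>s\<close> one level higher; the admissible pair \<open>p\<close>, \<open>r\<close> puts
      their product at level \<open>p\<close>, against the minimality of \<open>r\<close>.\<close>
    then have "bounded_functional sc (N p) (A p r * E * C) unit"
      using mul_right_bound[OF pr s(2,1) v(2,1)] by simp
    then have "Q p" using A_pos[OF pr] s v unfolding Q_def by (meson less_imp_le mult_nonneg_nonneg)
    then have "r \<le> p" unfolding r_def by (rule Least_le)
    then show False using p by simp
  qed
  then show ?thesis using that u bounded_functional_level_mono[of 0 U unit p] by simp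
qed

text \<open>Here \<open>unit\<close> need not be bounded at level \<open>p\<close>, so the inverse is sought in the
  form \<open>unit + s\<close> with \<open>s - mul c s = c\<close>.\<close>

lemma one_minus_invertible:
  assumes pq: "real p > real q + d"
    and c: "bounded_functional sc (N q) C c" "C \<ge> 0" "A p q * C < 1"
  shows "alg_invertible (cn_dual sc N) mul unit (unit - c)"
proof -
  note [simp] = unit_closed unit_left unit_right
  obtain D where D: "bounded_functional sc (N p) D c" "D \<ge> 0"
  proof (cases "q \<le> p")
    case True
    then show ?thesis using that[of C] c by (auto intro: bounded_functional_level_mono)
  next
    case False
    \<comment> \<open>Levels are integers, so \<open>p \<le> q - 1\<close>.\<close>
    then have "d < - 1" using pq by linarith
    then obtain U where U: "U \<ge> 0" "bounded_functional sc (N p) U unit"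
      by (rule unit_bounded_everywhere)
    have "bounded_functional sc (N p) (A p q * C * U) (mul c unit)"
      using c U by (intro mul_left_bound pq)
    moreover have "mul c unit = c" using c by (intro unit_right cn_dualI)
    ultimately show ?thesis using that[of "A p q * C * U"] A_pos[OF pq] c U by simp
  qed
  obtain s E where s: "E \<ge> 0" "bounded_functional sc (N p) E s" "s - mul c s = c"
    by (rule neumann_left[OF pq c D])
  obtain t E' where t: "E' \<ge> 0" "bounded_functional sc (N p) E' t" "t - mul t c = c"
    by (rule neumann_right[OF pq c D])
  have [simp]: "c \<in> cn_dual sc N" "s \<in> cn_dual sc N" "t \<in> cn_dual sc N"
    using c s t by (auto intro: cn_dualI)
  have right: "mul (unit - c) (unit + s) = unit"
    using s(3) by (simp add: mul_diff_left mul_add_right cn_dual_add) (simp add: algebra_simps)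
  have left: "mul (unit + t) (unit - c) = unit"
    using t(3) by (simp add: mul_diff_right mul_add_left cn_dual_add) (simp add: algebra_simps)
  \<comment> \<open>A left inverse and a right inverse coincide by associativity.\<close>
  have "unit + t = mul (unit + t) (mul (unit - c) (unit + s))"
    by (simp add: right cn_dual_add)
  also have "\<dots> = mul (mul (unit + t) (unit - c)) (unit + s)"
    by (simp add: mul_assoc cn_dual_add cn_dual_diff)
  also have "\<dots> = unit + s"
    by (simp add: left cn_dual_add)
  finally have "unit + t = unit + s" .
  with left right show ?thesis
    by (auto simp: alg_invertible_def cn_dual_add intro!: bexI[of _ "unit + s"])
qed

section \<open>From invertibility to the spectral bound\<close>

lemma alg_invertible_scale:
  assumes "alg_invertible (cn_dual sc N) mul unit a" "a \<in> cn_dual sc N" "z \<noteq> 0"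
  shows "alg_invertible (cn_dual sc N) mul unit (\<lambda>x. z * a x)"
proof -
  obtain b where b: "b \<in> cn_dual sc N" "mul a b = unit" "mul b a = unit"
    using assms by (auto simp: alg_invertible_def)
  have "mul (\<lambda>x. z * a x) (\<lambda>x. (1 / z) * b x) = unit"
    using assms b by (subst mul_scale_left mul_scale_right; simp add: cn_dual_scale)+
  moreover have "mul (\<lambda>x. (1 / z) * b x) (\<lambda>x. z * a x) = unit"
    using assms b by (subst mul_scale_left mul_scale_right; simp add: cn_dual_scale)+
  ultimately show ?thesis
    using cn_dual_scale[OF b(1), of "1 / z"] unfolding alg_invertible_def by blast
qed

text \<open>If the bound fails, then \<open>z\<close> is nonzero and
  \<open>a - z = - z * (1 - a / z)\<close>, where \<open>a / z\<close> is small enough for the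
  Neumann argument; so \<open>z\<close> is not in the spectrum.\<close>

lemma spectrum_bound:
  assumes pq: "real p > real q + d"
    and z: "z \<in> alg_spectrum (cn_dual sc N) mul unit a"
  shows "ennreal (cmod z) \<le> ennreal (A p q) * dual_norm sc (N q) a"
proof (rule ccontr)
  assume "\<not> ?thesis"
  then have less: "ennreal (A p q) * dual_norm sc (N q) a < ennreal (cmod z)" by simp
  have pos: "A p q > 0" by (rule A_pos[OF pq])
  \<comment> \<open>Positivity of \<open>A p q\<close> makes the product infinite whenever the norm
    is, which the strict inequality excludes.\<close>
  have "dual_norm sc (N q) a < top"
    using less pos by (cases "dual_norm sc (N q) a = top") (auto simp: less_top ennreal_mult_top)
  then have "a \<in> banach_dual sc (N q)" by (rule level.dual_norm_less_top)
  then obtain C where C: "C \<ge> 0" "dual_norm sc (N q) a = ennreal C" "bounded_functional sc (N q) C a"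
    by (rule level.banach_dual_bounded_functional)
  have lt: "A p q * C < cmod z"
    using less pos C by (simp add: ennreal_less_iff flip: ennreal_mult)
  have z0: "z \<noteq> 0"
  proof
    assume "z = 0"
    then have "A p q * C < 0" using lt by simp
    then show False using pos C by (simp add: mult_less_0_iff)
  qed
  define c where "c = (\<lambda>x. (1 / z) * a x)"
  have c: "bounded_functional sc (N q) (cmod (1 / z) * C) c"
    unfolding c_def by (rule bounded_functional_scale[OF C(3)])
  have "alg_invertible (cn_dual sc N) mul unit (unit - c)"
    using C z0 lt by (intro one_minus_invertible[OF pq c]) (auto simp: norm_divide field_simps)
  moreover have "unit - c \<in> cn_dual sc N"
    using C by (intro cn_dual_diff unit_closed cn_dualI[OF c]) auto
  ultimately have "alg_invertible (cn_dual sc N) mul unit (\<lambda>x. - z * (unit - c) x)"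
    by (rule alg_invertible_scale) (use z0 in simp)
  also have "(\<lambda>x. - z * (unit - c) x) = a - (\<lambda>x. z * unit x)"
    using z0 by (simp add: fun_eq_iff c_def algebra_simps)
  finally show False using z unfolding alg_spectrum_def by blast
qed

end

theorem theorem2p10:
  fixes sc :: "complex \<Rightarrow> 'v::ab_group_add \<Rightarrow> 'v"
    and N :: "nat \<Rightarrow> 'v \<Rightarrow> real"
    and mul :: "('v \<Rightarrow> complex) \<Rightarrow> ('v \<Rightarrow> complex) \<Rightarrow> ('v \<Rightarrow> complex)"
    and d :: real
    and A :: "nat \<Rightarrow> nat \<Rightarrow> real"
    and unit a :: "'v \<Rightarrow> complex"
  assumes "unital_strong_algebra sc N mul d A unit"
    and "a \<in> cn_dual sc N"
  shows "alg_spectrum (cn_dual sc N) mul unit a \<subseteq>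
    {z. ennreal (cmod z) \<le>
        (INF (p, q)\<in>{(p, q). real p > real q + d}. ennreal (A p q) * dual_norm sc (N q) a)}"
proof -
  interpret unital_strong_algebra sc N mul d A unit by fact
  show ?thesis by (auto intro!: INF_greatest spectrum_bound)
qed

end
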